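(* For each $p\in\left(\frac{N}{s},\infty\right)$ the following hold: (i) $\Lambda_1(p)>0$; (ii) there exists $(u_p,v_p)\in X^*_{s,t,p}(\Omega)$ such that $\Lambda_1(p)=Q_{s,t,p}(u_p,v_p)$, with $u_p,v_p>0$ in $\Omega$ and $\left(\int_\Omega |u_p|^{\alpha(p)}\,dx\right)|v_p(x_0)|^{\beta(p)}=1$.
   Context: Let $\Omega\subset\mathbb{R}^N$ be a bounded, smooth domain, $0<s\le t<1$, and $x_0\in\Omega$ fixed. Let $\alpha,\beta\colon\left(\frac{N}{s},\infty\right)\to(1,\infty)$ satisfy $\alpha(p)+\beta(p)=p$ for all $p\in\left(\frac{N}{s},\infty\right)$ and $\lim_{p\to\infty}\alpha(p)/p=\theta\in(0,1)$. For $0<r<1$ and $1\le p<\infty$ let $[u]_{r,p}^p=\int_{\mathbb{R}^N}\int_{\mathbb{R}^N}\frac{|u(x)-u(y)|^p}{|x-y|^{N+rp}}\,dx\,dy$ and $W^{r,p}_0(\Omega)=\{u\in L^p(\mathbb{R}^N): u=0 \text{ in }\mathbb{R}^N\setminus\Omega,\ [u]_{r,p}<\infty\}$. For $p>N/s$ the elements of $W^{s,p}_0(\Omega)$ and $W^{t,p}_0(\Omega)$ are identified with their continuous representatives. Put $X_{s,t,p}(\Omega)=W^{s,p}_0(\Omega)\times W^{t,p}_0(\Omega)$ and $$X^*_{s,t,p}(\Omega)=\left\{(u,v)\in X_{s,t,p}(\Omega): \left(\int_\Omega|u|^{\alpha(p)}\,dx\right)v(x_0)\ne0\right\}.$$ For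 $p\in\left(\frac{N}{s},\infty\right)$ and $(u,v)\in X^*_{s,t,p}(\Omega)$ define $$Q_{s,t,p}(u,v)=\frac{\frac1p[u]_{s,p}^p+\frac1p[v]_{t,p}^p}{\left(\int_\Omega|u|^{\alpha(p)}\,dx\right)|v(x_0)|^{\beta(p)}},\qquad \Lambda_1(p)=\inf_{(u,v)\in X^*_{s,t,p}(\Omega)}Q_{s,t,p}(u,v).$$ *)

theory Defs
  imports "HOL-Analysis.Analysis"
begin

text \<open>
  \<open>C_diff k f\<close>: \<open>f\<close> is of class \<open>C\<^sup>k\<close> on the whole space. Continuity of all directional
  derivatives of order at most \<open>k\<close> amounts in finite dimension to continuity of the
  multilinear Frechet derivatives of order at most \<open>k\<close>.
\<close>

primrec C_diff :: "nat \<Rightarrow> ('a::euclidean_space \<Rightarrow> real) \<Rightarrow> bool" where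
  "C_diff 0 f \<longleftrightarrow> continuous_on UNIV f"
| "C_diff (Suc k) f \<longleftrightarrow>
     f differentiable_on UNIV \<and> (\<forall>v. C_diff k (\<lambda>x. frechet_derivative f (at x) v))"

definition smooth :: "('a::euclidean_space \<Rightarrow> real) \<Rightarrow> bool" where
  "smooth f \<longleftrightarrow> (\<forall>k. C_diff k f)"

text \<open>
  Near each boundary point the set is the open epigraph, in the direction of a unit vector
  \<open>e\<close>, of a smooth function of the coordinates orthogonal to \<open>e\<close>; the argument of \<open>\<gamma>\<close> below is
  the orthogonal projection of \<open>x\<close> to the hyperplane orthogonal to \<open>e\<close>.
\<close>

definition smooth_boundary :: "'a::euclidean_space set \<Rightarrow> bool" where
  "smooth_boundary \<Omega> \<longleftrightarrow>
     (\<forall>z\<in>frontier \<Omega>. \<exists>r>0. \<exists>e \<gamma>. norm e = 1 \<and> smooth \<gamma> \<and>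
        \<Omega> \<inter> ball z r = {x \<in> ball z r. \<gamma> (x - (x \<bullet> e) *\<^sub>R e) < x \<bullet> e})"

definition bounded_smooth_domain :: "'a::euclidean_space set \<Rightarrow> bool" where
  "bounded_smooth_domain \<Omega> \<longleftrightarrow>
     open \<Omega> \<and> connected \<Omega> \<and> \<Omega> \<noteq> {} \<and> bounded \<Omega> \<and> smooth_boundary \<Omega>"

text \<open>
  The \<open>p\<close>-th power \<open>[u]\<^sup>p\<close> of the Gagliardo seminorm of order \<open>r\<close>, possibly infinite.
  On the diagonal the integrand is \<open>0 / 0 = 0\<close>, which affects only a null set.
\<close>

definition gagliardo_pow :: "real \<Rightarrow> real \<Rightarrow> ('a::euclidean_space \<Rightarrow> real) \<Rightarrow> ennreal" where
  "gagliardo_pow r p u =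
     (\<integral>\<^sup>+x. (\<integral>\<^sup>+y. ennreal (\<bar>u x - u y\<bar> powr p / norm (x - y) powr (real DIM('a) + r * p))
        \<partial>lebesgue) \<partial>lebesgue)"

text \<open>
  The elements of the following set are functions rather than classes modulo almost everywhere
  equality; the condition \<open>u = 0\<close> outside \<open>\<Omega>\<close> is accordingly an almost everywhere condition.
\<close>

definition W0 :: "real \<Rightarrow> real \<Rightarrow> 'a::euclidean_space set \<Rightarrow> ('a \<Rightarrow> real) set" where
  "W0 r p \<Omega> =
     {u. u \<in> borel_measurable lebesgue \<and> integrable lebesgue (\<lambda>x. \<bar>u x\<bar> powr p) \<and>
         (AE x in lebesgue. x \<notin> \<Omega> \<longrightarrow> u x = 0) \<and> gagliardo_pow r p u < \<infinity>}"

text \<open>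
  Each class is represented by its continuous member, which is unique. Such a member vanishes
  at every point outside \<open>\<Omega>\<close> when \<open>\<Omega>\<close> has smooth boundary.
\<close>

definition X_space :: "real \<Rightarrow> real \<Rightarrow> real \<Rightarrow> 'a::euclidean_space set \<Rightarrow>
    (('a \<Rightarrow> real) \<times> ('a \<Rightarrow> real)) set" where
  "X_space s t p \<Omega> =
     {u \<in> W0 s p \<Omega>. continuous_on UNIV u} \<times> {v \<in> W0 t p \<Omega>. continuous_on UNIV v}"

definition X_star :: "real \<Rightarrow> real \<Rightarrow> (real \<Rightarrow> real) \<Rightarrow> 'a::euclidean_space set \<Rightarrow> 'a \<Rightarrow> real \<Rightarrow>
    (('a \<Rightarrow> real) \<times> ('a \<Rightarrow> real)) set" where
  "X_star s t \<alpha> \<Omega> x0 p =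
     {(u, v) \<in> X_space s t p \<Omega>. (LINT x:\<Omega>|lebesgue. \<bar>u x\<bar> powr \<alpha> p) * v x0 \<noteq> 0}"

definition Q :: "real \<Rightarrow> real \<Rightarrow> (real \<Rightarrow> real) \<Rightarrow> (real \<Rightarrow> real) \<Rightarrow> 'a::euclidean_space set \<Rightarrow>
    'a \<Rightarrow> real \<Rightarrow> ('a \<Rightarrow> real) \<Rightarrow> ('a \<Rightarrow> real) \<Rightarrow> real" where
  "Q s t \<alpha> \<beta> \<Omega> x0 p u v =
     (1 / p * enn2real (gagliardo_pow s p u) + 1 / p * enn2real (gagliardo_pow t p v)) /
     ((LINT x:\<Omega>|lebesgue. \<bar>u x\<bar> powr \<alpha> p) * \<bar>v x0\<bar> powr \<beta> p)"

definition Lambda1 :: "real \<Rightarrow> real \<Rightarrow> (real \<Rightarrow> real) \<Rightarrow> (real \<Rightarrow> real) \<Rightarrow>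
    'a::euclidean_space set \<Rightarrow> 'a \<Rightarrow> real \<Rightarrow> real" where
  "Lambda1 s t \<alpha> \<beta> \<Omega> x0 p = (INF (u, v)\<in>X_star s t \<alpha> \<Omega> x0 p. Q s t \<alpha> \<beta> \<Omega> x0 p u v)"

end

theory Submission
  imports Defs "HOL-Complex_Analysis.Great_Picard"
begin

text \<open>
  Since \<open>s p > N\<close>, a fractional Morrey inequality bounds the \<open>(s - N/p)\<close>-Hoelder seminorm of a
  continuous function by its Gagliardo seminorm. Because \<open>\<alpha> + \<beta> = p\<close>, the quotient is invariant
  under \<open>(u, v) \<mapsto> (c u, c v)\<close>, so a minimising sequence can be taken with denominator one; by Morrey
  and Arzela-Ascoli it converges uniformly along a subsequence, and Fatou's lemma makes the limit a
  minimiser, which may be replaced by \<open>(\<bar>u\<bar>, \<bar>v\<bar>)\<close>.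

  Enlarging one component of a nonnegative minimiser enlarges the denominator, hence cannot decrease
  that component's seminorm, so each component is a weak supersolution. Testing with
  \<open>\<psi>\<^sup>p (u + \<delta>)\<^sup>1\<^sup>-\<^sup>p\<close> bounds the local Gagliardo seminorm of \<open>ln (u + \<delta>)\<close> uniformly in \<open>\<delta>\<close>; by Morrey
  the oscillation of \<open>ln (u + \<delta>)\<close> on small balls is bounded uniformly in \<open>\<delta>\<close>, so a zero of \<open>u\<close>
  propagates to a neighbourhood and, \<open>\<Omega>\<close> being connected, to all of \<open>\<Omega>\<close>.
\<close>

section \<open>The Gagliardo seminorm of Lipschitz functions\<close>

text \<open>The point evaluation \<open>v x0\<close> would put a Dirac mass into the Euler-Lagrange
  equation of the second component. Comparing energies under nonnegative perturbations avoids
  differentiating the denominator and treats both components alike; it yields only an inequality,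
  and the logarithmic test needs no more than that. A logarithmic estimate usually controls mean
  oscillation alone and calls for an iteration. Here the exponent that makes functions Hoelder
  continuous also turns that estimate into a pointwise one, provided the Morrey inequality is local:
  the energy of \<open>ln (u + \<delta>)\<close> is bounded on a ball only. The shift \<delta> keeps
  the test function Lipschitz in \<open>u\<close> and in the cutoff. Its Lipschitz constant blows up
  as \<delta> tends to 0, which is harmless because it only certifies finite energy; the final bound
  is the energy of the cutoff, in which \<delta> does not occur. In the proof of the Morrey
  inequality the usual Hoelder estimate is replaced by a pointwise splitting at a free level
  \<open>l\<close>, fixed after integration.\<close>

definition gagliardo_integrand :: "real \<Rightarrow> real \<Rightarrow> ('a::euclidean_space \<Rightarrow> real) \<Rightarrow> 'a \<times> 'a \<Rightarrow> real" where
  "gagliardo_integrand r p u z =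
     \<bar>u (fst z) - u (snd z)\<bar> powr p / norm (fst z - snd z) powr (real DIM('a) + r * p)"

lemma gagliardo_integrand_nonneg [simp]: "0 \<le> gagliardo_integrand r p u z"
  by (simp add: gagliardo_integrand_def)

lemma borel_measurable_fst_snd:
  fixes u :: "'a::euclidean_space \<Rightarrow> real"
  assumes "u \<in> borel_measurable borel"
  shows "(\<lambda>z::'a \<times> 'a. u (fst z)) \<in> borel_measurable borel"
    and "(\<lambda>z::'a \<times> 'a. u (snd z)) \<in> borel_measurable borel"
  using measurable_compose[OF measurable_fst assms, of "borel :: 'a measure"]
    measurable_compose[OF measurable_snd assms, of "borel :: 'a measure"]
  by (simp_all add: borel_prod)

lemma borel_measurable_gagliardo_integrand [measurable]:
  fixes u :: "'a::euclidean_space \<Rightarrow> real"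
  assumes "u \<in> borel_measurable borel"
  shows "gagliardo_integrand r p u \<in> borel_measurable borel"
proof -
  note [measurable] = borel_measurable_fst_snd[OF assms]
  have [measurable]: "(\<lambda>z::'a \<times> 'a. norm (fst z - snd z)) \<in> borel_measurable borel"
    by (intro borel_measurable_continuous_onI continuous_intros)
  show ?thesis
    unfolding gagliardo_integrand_def[abs_def] by measurable
qed

text \<open>Tonelli's theorem, after passing from the completed to the Borel measure. A single
  integral over pairs makes dominated convergence and Fatou's lemma directly applicable.\<close>

lemma gagliardo_pow_eq_nn_integral:
  fixes u :: "'a::euclidean_space \<Rightarrow> real"
  assumes "u \<in> borel_measurable borel"
  shows "gagliardo_pow r p u = (\<integral>\<^sup>+z. gagliardo_integrand r p u z \<partial>lborel)"
proof -
  have m: "(\<lambda>z. ennreal (gagliardo_integrand r p u z)) \<in> borel_measurable (lborel \<Otimes>\<^sub>M lborel)"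
    using borel_measurable_gagliardo_integrand[OF assms]
    by (simp add: lborel_prod)
  have "gagliardo_pow r p u =
      (\<integral>\<^sup>+x. (\<integral>\<^sup>+y. gagliardo_integrand r p u (x, y) \<partial>lborel) \<partial>lborel)"
    by (simp add: gagliardo_pow_def nn_integral_completion gagliardo_integrand_def)
  also have "\<dots> = (\<integral>\<^sup>+z. gagliardo_integrand r p u z \<partial>(lborel \<Otimes>\<^sub>M lborel))"
    by (rule lborel.nn_integral_fst[OF m])
  finally show ?thesis
    by (simp add: lborel_prod)
qed

text \<open>The series of \<open>c j\<close> times the indicator of the \<open>j\<close>-th ball
  dominates \<open>f\<close>, and the volume of that ball is a constant times
  \<open>R j ^ DIM('a)\<close>. With dyadic radii this replaces integration in polar
  coordinates.\<close>

lemma nn_integral_le_suminf_cball: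
  fixes f :: "'a::euclidean_space \<Rightarrow> ennreal" and R c :: "nat \<Rightarrow> real"
  assumes cover: "\<And>h. f h \<noteq> 0 \<Longrightarrow> \<exists>j. norm h \<le> R j \<and> f h \<le> ennreal (c j)"
    and R: "\<And>j. 0 \<le> R j" and c: "\<And>j. 0 \<le> c j"
    and sm: "summable (\<lambda>j. c j * R j ^ DIM('a))"
  shows "(\<integral>\<^sup>+h. f h \<partial>lborel) < \<infinity>"
proof -
  have "f h \<le> (\<Sum>j. ennreal (c j) * indicator (cball 0 (R j)) h)" for h
  proof (cases "f h = 0")
    case False
    then obtain j where j: "norm h \<le> R j" "f h \<le> ennreal (c j)"
      using cover by blast
    have "f h \<le> (\<Sum>i\<in>{j}. ennreal (c i) * indicator (cball 0 (R i)) h)"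
      using j by simp
    also have "\<dots> \<le> (\<Sum>i. ennreal (c i) * indicator (cball 0 (R i)) h)"
      by (rule sum_le_suminf) auto
    finally show ?thesis .
  qed simp
  then have "(\<integral>\<^sup>+h. f h \<partial>lborel) \<le>
      (\<integral>\<^sup>+h. (\<Sum>j. ennreal (c j) * indicator (cball 0 (R j)) (h::'a)) \<partial>lborel)"
    by (intro nn_integral_mono) simp
  also have "\<dots> = (\<Sum>j. \<integral>\<^sup>+h. ennreal (c j) * indicator (cball 0 (R j)) (h::'a) \<partial>lborel)"
    by (rule nn_integral_suminf) (intro borel_measurable_times_ennreal borel_measurable_indicator, auto)
  also have "\<dots> = (\<Sum>j. ennreal (unit_ball_vol DIM('a) * (c j * R j ^ DIM('a))))"
    using R c
    by (intro suminf_cong)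
      (simp add: nn_integral_cmult_indicator emeasure_cball ennreal_mult'[symmetric] mult_ac)
  also have "\<dots> < \<infinity>"
  proof -
    have "summable (\<lambda>j. unit_ball_vol DIM('a) * (c j * R j ^ DIM('a)))"
      using sm by (rule summable_mult)
    then have "(\<Sum>j. ennreal (unit_ball_vol DIM('a) * (c j * R j ^ DIM('a)))) =
      ennreal (\<Sum>j. unit_ball_vol DIM('a) * (c j * R j ^ DIM('a)))"
      by (intro suminf_ennreal2) (auto simp: R c)
    then show ?thesis by simp
  qed
  finally show ?thesis .
qed

text \<open>For \<open>norm h\<close> between \<open>(1/2) ^ (j + 1)\<close> and
  \<open>(1/2) ^ j\<close> the power is comparable to \<open>(1/2) powr (e * j)\<close>. Weighted
  with the volume of the ball this gives a geometric series of ratio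
  \<open>(1/2) powr (e + DIM('a))\<close>, below 1 by the assumption on \<open>e\<close>.\<close>

lemma nn_integral_powr_near_finite:
  fixes e :: real
  assumes "- real DIM('a::euclidean_space) < e"
  shows "(\<integral>\<^sup>+h. indicator (cball 0 1) (h::'a) * ennreal (norm h powr e) \<partial>lborel) < \<infinity>"
proof (rule nn_integral_le_suminf_cball[where R = "\<lambda>j. (1/2) ^ j"
      and c = "\<lambda>j. 2 powr \<bar>e\<bar> * (1/2) powr (e * real j)"])
  fix h :: 'a
  assume "indicator (cball 0 1) h * ennreal (norm h powr e) \<noteq> 0"
  then have h: "norm h \<le> 1" "h \<noteq> 0" "0 < norm h"
    by (auto simp: indicator_def split: if_splits)
  define j where "j = nat \<lfloor>log (1/2) (norm h)\<rfloor>"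
  have l0: "0 \<le> log (1/2) (norm h)"
    using h by (simp add: log_def ln_div divide_nonpos_pos)
  then have jl: "real j \<le> log (1/2) (norm h)" "log (1/2) (norm h) \<le> real j + 1"
    unfolding j_def by linarith+
  define x where "x = log (1/2) (norm h)"
  have nh: "norm h = (1/2) powr x"
    using h by (simp add: x_def)
  have le: "norm h \<le> (1/2) ^ j"
    using jl(1) unfolding nh x_def[symmetric]
    by (simp add: powr_realpow[symmetric] powr_mono')
  have "norm h powr e = (1/2) powr (e * x)"
    by (simp add: nh powr_powr mult.commute)
  \<comment> \<open>Since \<open>x - j\<close> lies between 0 and 1, replacing \<open>x\<close> by
    \<open>j\<close> changes the exponent by at most \<open>\<bar>e\<bar>\<close>, whatever the sign
    of \<open>e\<close>. This is the origin of the factor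
    \<open>2 powr \<bar>e\<bar>\<close>.\<close>
  also have "\<dots> \<le> (1/2) powr (e * real j - \<bar>e\<bar>)"
  proof (rule powr_mono')
    have "\<bar>e * (x - real j)\<bar> \<le> \<bar>e\<bar> * 1"
      unfolding abs_mult using jl by (intro mult_left_mono) (auto simp: x_def)
    then show "e * real j - \<bar>e\<bar> \<le> e * x"
      by (simp add: algebra_simps abs_le_iff)
  qed auto
  also have "\<dots> = 2 powr \<bar>e\<bar> * (1/2) powr (e * real j)"
    by (simp add: powr_diff powr_divide)
  finally show "\<exists>j. norm h \<le> (1 / 2) ^ j \<and>
      indicator (cball 0 1) h * ennreal (norm h powr e)
         \<le> ennreal (2 powr \<bar>e\<bar> * (1 / 2) powr (e * real j))"
    using le h by (intro exI[of _ j]) (auto simp: ennreal_leI)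
next
  have eq: "2 powr \<bar>e\<bar> * (1/2) powr (e * real j) * ((1/2) ^ j) ^ DIM('a) =
      2 powr \<bar>e\<bar> * ((1/2) powr (e + real DIM('a))) ^ j" for j
  proof -
    have "((1/2::real) ^ j) ^ DIM('a) = (1/2) powr (real DIM('a) * real j)"
      by (simp add: powr_powr power_mult[symmetric] powr_realpow[symmetric] mult.commute)
    moreover have "((1/2::real) powr (e + real DIM('a))) ^ j = (1/2) powr ((e + real DIM('a)) * real j)"
      by (simp add: powr_powr[symmetric] powr_realpow[symmetric])
    ultimately show ?thesis
      by (simp add: powr_add[symmetric] algebra_simps)
  qed
  have "(1/2::real) powr (e + real DIM('a)) < 1"
    using assms powr_less_mono'[of "1/2" 0 "e + real DIM('a)"] by simp
  then show "summable (\<lambda>j. 2 powr \<bar>e\<bar> * (1/2) powr (e * real j) * ((1/2) ^ j) ^ DIM('a))"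
    unfolding eq by (intro summable_mult summable_geometric) simp
qed auto

text \<open>The same dyadic argument at infinity, with \<open>norm h\<close> between
  \<open>2 ^ j\<close> and \<open>2 * 2 ^ j\<close> and ratio
  \<open>2 powr (DIM('a) - e)\<close>.\<close>

lemma nn_integral_powr_far_finite:
  fixes e :: real
  assumes "real DIM('a::euclidean_space) < e"
  shows "(\<integral>\<^sup>+h. indicator (- cball 0 1) (h::'a) * ennreal (1 / norm h powr e) \<partial>lborel) < \<infinity>"
proof (rule nn_integral_le_suminf_cball[where R = "\<lambda>j. 2 * 2 ^ j"
      and c = "\<lambda>j. 1 / (2 ^ j) powr e"])
  fix h :: 'a
  assume "indicator (- cball 0 1) h * ennreal (1 / norm h powr e) \<noteq> 0"
  then have h: "1 < norm h"
    by (auto simp: indicator_def split: if_splits)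
  define x where "x = log 2 (norm h)"
  define j where "j = nat \<lfloor>x\<rfloor>"
  have "0 \<le> x"
    using h by (simp add: x_def log_def)
  then have jl: "real j \<le> x" "x \<le> real j + 1"
    unfolding j_def by linarith+
  have "0 < norm h"
    using h by linarith
  then have nh: "norm h = 2 powr x"
    by (simp add: x_def)
  have "norm h \<le> 2 powr (real j + 1)"
    unfolding nh using jl by (intro powr_mono) auto
  then have le: "norm h \<le> 2 * 2 ^ j"
    by (simp add: powr_add powr_realpow)
  have "2 powr (real j) \<le> norm h"
    unfolding nh using jl by (intro powr_mono) auto
  then have "(2 ^ j) powr e \<le> norm h powr e"
    using assms by (intro powr_mono2) (auto simp: powr_realpow)
  then have "1 / norm h powr e \<le> 1 / (2 ^ j) powr e"
    using h by (intro divide_left_mono mult_pos_pos) auto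
  then show "\<exists>j. norm h \<le> 2 * 2 ^ j \<and>
      indicator (- cball 0 1) h * ennreal (1 / norm h powr e) \<le> ennreal (1 / (2 ^ j) powr e)"
    using le h by (intro exI[of _ j]) (auto simp: ennreal_leI)
next
  have eq: "1 / (2 ^ j) powr e * (2 * 2 ^ j) ^ DIM('a) =
      2 ^ DIM('a) * (2 powr (real DIM('a) - e)) ^ j" for j
  proof -
    have "(2 ^ j :: real) ^ DIM('a) = 2 powr (real DIM('a) * real j)"
      by (simp add: powr_powr power_mult[symmetric] powr_realpow[symmetric] mult.commute)
    moreover have "(2 ^ j :: real) powr e = 2 powr (e * real j)"
      by (simp add: powr_powr powr_realpow[symmetric] mult.commute)
    moreover have "((2::real) powr (real DIM('a) - e)) ^ j = 2 powr ((real DIM('a) - e) * real j)"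
      by (simp add: powr_powr[symmetric] powr_realpow[symmetric])
    ultimately show ?thesis
      by (simp add: powr_diff power_mult_distrib algebra_simps)
  qed
  have "2 powr (real DIM('a) - e) < (1::real)"
    using assms powr_less_mono[of "real DIM('a) - e" 0 2] by simp
  then show "summable (\<lambda>j. 1 / (2 ^ j) powr e * (2 * 2 ^ j) ^ DIM('a) :: real)"
    unfolding eq by (intro summable_mult summable_geometric) simp
qed auto

lemma nn_integral_lborel_reflect_translate:
  fixes f :: "'a::euclidean_space \<Rightarrow> ennreal"
  assumes f: "f \<in> borel_measurable borel" and even: "\<And>h. f (- h) = f h"
  shows "(\<integral>\<^sup>+y. f (x - y) \<partial>lborel) = (\<integral>\<^sup>+h. f h \<partial>lborel)"
proof -
  have "(\<integral>\<^sup>+h. f h \<partial>lborel) = (\<integral>\<^sup>+h. f h \<partial>distr lborel borel ((+) (- x)))"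
    by (simp add: lborel_distr_plus)
  also have "\<dots> = (\<integral>\<^sup>+y. f (- x + y) \<partial>lborel)"
    using f by (subst nn_integral_distr) auto
  also have "\<dots> = (\<integral>\<^sup>+y. f (x - y) \<partial>lborel)"
    using even[of "x - _"] by (intro nn_integral_cong) simp
  finally show ?thesis by simp
qed

text \<open>Near the diagonal the Lipschitz bound leaves the exponent
  \<open>p - r p - DIM('a)\<close>, integrable since \<open>r < 1\<close>; far from it the bound by
  1 leaves the decay \<open>DIM('a) + r p\<close>, integrable since \<open>r > 0\<close>. The lemma
  supplies the finite energy of the cutoff functions.\<close>

lemma gagliardo_pow_lipschitz_finite:
  fixes \<psi> :: "'a::euclidean_space \<Rightarrow> real"
  assumes r: "0 < r" "r < 1" and p: "0 < p"
    and lip: "\<And>x y. \<bar>\<psi> x - \<psi> y\<bar> \<le> L * norm (x - y)"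
    and bdd: "\<And>x y. \<bar>\<psi> x - \<psi> y\<bar> \<le> 1"
    and supp: "\<And>x. x \<notin> cball c \<rho> \<Longrightarrow> \<psi> x = 0"
  shows "gagliardo_pow r p \<psi> < \<infinity>"
proof -
  define C where "C = cball c \<rho>"
  define k1 where "k1 h = indicator (cball 0 1) h * ennreal (norm h powr (p - (real DIM('a) + r * p)))" for h :: 'a
  define k2 where "k2 h = indicator (- cball 0 1) h * ennreal (1 / norm h powr (real DIM('a) + r * p))" for h :: 'a
  define K where "K h = ennreal (L powr p) * k1 h + k2 h" for h
  have Lnn: "0 \<le> L"
  proof -
    obtain b :: 'a where b: "b \<in> Basis" using nonempty_Basis by blast
    show ?thesis using order_trans[OF abs_ge_zero lip[of b 0]] b by simp
  qed
  have [measurable]: "C \<in> sets borel" by (simp add: C_def)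
  have km: "(\<lambda>h::'a. norm h powr e) \<in> borel_measurable borel"
    "(\<lambda>h::'a. 1 / norm h powr e) \<in> borel_measurable borel" for e
    by measurable
  have [measurable]: "k1 \<in> borel_measurable borel" "k2 \<in> borel_measurable borel"
    unfolding k1_def[abs_def] k2_def[abs_def]
    by (intro borel_measurable_times_ennreal borel_measurable_indicator
        measurable_compose[OF km(1) measurable_ennreal]
        measurable_compose[OF km(2) measurable_ennreal]; simp)+
  have Km [measurable]: "K \<in> borel_measurable borel"
    unfolding K_def[abs_def] by measurable
  have Keven: "K (- h) = K h" for h
    by (simp add: K_def k1_def k2_def indicator_def)
  have Kfin: "(\<integral>\<^sup>+h. K h \<partial>lborel) < \<infinity>"
  proof -
    have "- real DIM('a) < p - (real DIM('a) + r * p)"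
      using p r mult_strict_right_mono[of r 1 p] by simp
    from nn_integral_powr_near_finite[OF this]
    have 1: "(\<integral>\<^sup>+h. k1 h \<partial>lborel) < \<infinity>"
      unfolding k1_def .
    have "real DIM('a) < real DIM('a) + r * p"
      using p r by simp
    from nn_integral_powr_far_finite[OF this]
    have 2: "(\<integral>\<^sup>+h. k2 h \<partial>lborel) < \<infinity>"
      unfolding k2_def .
    have "(\<integral>\<^sup>+h. K h \<partial>lborel) =
        ennreal (L powr p) * (\<integral>\<^sup>+h. k1 h \<partial>lborel) + (\<integral>\<^sup>+h. k2 h \<partial>lborel)"
      unfolding K_def by (simp add: nn_integral_add nn_integral_cmult)
    then show ?thesis
      using 1 2 by (simp add: ennreal_mult_less_top)
  qed
  have Cfin: "emeasure lborel C < \<infinity>"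
    unfolding C_def using emeasure_bounded_finite[of "cball c \<rho>"] by simp
  \<comment> \<open>The integrand vanishes unless one of the points is in \<open>C\<close>. Each
    summand is an indicator in one variable times an even function of \<open>x - y\<close>, so its
    double integral is the volume of \<open>C\<close> times the integral of
    \<open>K\<close>.\<close>
  have pt: "ennreal (gagliardo_integrand r p \<psi> (x, y)) \<le> indicator C x * K (x - y) + indicator C y * K (x - y)"
    for x y
  proof (cases "x \<in> C \<or> y \<in> C")
    case False
    then have "\<psi> x = 0" "\<psi> y = 0" using supp by (auto simp: C_def)
    then show ?thesis using False by (simp add: gagliardo_integrand_def p)
  next
    case True
    let ?h = "x - y"
    have "ennreal (gagliardo_integrand r p \<psi> (x, y)) \<le> K ?h"
    proof (cases "?h = 0 \<or> norm ?h > 1")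
      case True
      then consider "?h = 0" | "norm ?h > 1" by blast
      then show ?thesis
      proof cases
        case 1 then show ?thesis by (simp add: gagliardo_integrand_def)
      next
        case 2
        have "\<bar>\<psi> x - \<psi> y\<bar> powr p \<le> 1"
          using bdd[of x y] p powr_mono2[of p "\<bar>\<psi> x - \<psi> y\<bar>" 1] by simp
        then have "gagliardo_integrand r p \<psi> (x, y) \<le> 1 / norm ?h powr (real DIM('a) + r * p)"
          unfolding gagliardo_integrand_def by (simp add: divide_right_mono)
        then show ?thesis
          using 2 by (simp add: K_def k1_def k2_def ennreal_leI)
      qed
    next
      case False
      then have h: "0 < norm ?h" "norm ?h \<le> 1" by auto
      have "\<bar>\<psi> x - \<psi> y\<bar> powr p \<le> (L * norm ?h) powr p"
        using p lip by (intro powr_mono2) auto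
      then have "gagliardo_integrand r p \<psi> (x, y) \<le> (L * norm ?h) powr p / norm ?h powr (real DIM('a) + r * p)"
        unfolding gagliardo_integrand_def by (simp add: divide_right_mono)
      also have "\<dots> = L powr p * norm ?h powr (p - (real DIM('a) + r * p))"
        using Lnn h by (simp add: powr_mult powr_diff)
      finally show ?thesis
        using h by (simp add: K_def k1_def k2_def ennreal_mult'[symmetric] ennreal_leI)
    qed
    also have "\<dots> \<le> indicator C x * K ?h + indicator C y * K ?h"
      using True by (auto simp: indicator_def)
    finally show ?thesis .
  qed
  have "continuous_on UNIV \<psi>"
    using lip Lnn by (intro lipschitz_on_continuous_on[of L] lipschitz_onI) (auto simp: dist_norm)
  then have \<psi>m: "\<psi> \<in> borel_measurable borel"
    by (rule borel_measurable_continuous_onI)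
  have inner: "(\<integral>\<^sup>+y. K (x - y) \<partial>lborel) = (\<integral>\<^sup>+h. K h \<partial>lborel)" for x
    by (rule nn_integral_lborel_reflect_translate[OF Km Keven])
  have "gagliardo_pow r p \<psi> =
      (\<integral>\<^sup>+x. (\<integral>\<^sup>+y. gagliardo_integrand r p \<psi> (x, y) \<partial>lborel) \<partial>lborel)"
    by (simp add: gagliardo_pow_def nn_integral_completion gagliardo_integrand_def)
  also have "\<dots> \<le> (\<integral>\<^sup>+x. (\<integral>\<^sup>+y. indicator C x * K (x - y) + indicator C y * K (x - y) \<partial>lborel) \<partial>lborel)"
    by (intro nn_integral_mono pt)
  also have "\<dots> = (\<integral>\<^sup>+x. indicator C x * (\<integral>\<^sup>+y. K (x - y) \<partial>lborel) \<partial>lborel) +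
      (\<integral>\<^sup>+x. (\<integral>\<^sup>+y. indicator C y * K (x - y) \<partial>lborel) \<partial>lborel)"
    by (simp add: nn_integral_add nn_integral_cmult)
  also have "(\<integral>\<^sup>+x. (\<integral>\<^sup>+y. indicator C y * K (x - y) \<partial>lborel) \<partial>lborel) =
      (\<integral>\<^sup>+y. (\<integral>\<^sup>+x. indicator C y * K (x - y) \<partial>lborel) \<partial>lborel)"
    by (rule lborel_pair.Fubini') simp
  also have "\<dots> = (\<integral>\<^sup>+y. indicator C y * (\<integral>\<^sup>+x. K (x - y) \<partial>lborel) \<partial>lborel)"
    by (simp add: nn_integral_cmult)
  also have "(\<lambda>y. \<integral>\<^sup>+x. K (x - y) \<partial>lborel) = (\<lambda>y. \<integral>\<^sup>+h. K h \<partial>lborel)"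
  proof
    fix y
    have "(\<integral>\<^sup>+x. K (x - y) \<partial>lborel) = (\<integral>\<^sup>+x. K (y - x) \<partial>lborel)"
      by (intro nn_integral_cong) (metis Keven minus_diff_eq)
    then show "(\<integral>\<^sup>+x. K (x - y) \<partial>lborel) = (\<integral>\<^sup>+h. K h \<partial>lborel)"
      by (simp add: inner)
  qed
  also have "(\<integral>\<^sup>+x. indicator C x * (\<integral>\<^sup>+y. K (x - y) \<partial>lborel) \<partial>lborel) +
       (\<integral>\<^sup>+y. indicator C y * (\<integral>\<^sup>+h. K h \<partial>lborel) \<partial>lborel) < \<infinity>"
    using Kfin Cfin by (simp add: inner nn_integral_multc ennreal_mult_less_top)
  finally show ?thesis .
qed

section \<open>A fractional Morrey inequality\<close>

text \<open>Above the level \<open>l\<close>, write \<open>t = t powr (1 - p) * t powr p\<close> and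
  use that the exponent \<open>1 - p\<close> is not positive. The bound is linear in
  \<open>t powr p\<close>, hence can be integrated before \<open>l\<close> is chosen.\<close>

lemma le_plus_powr:
  fixes t l p :: real
  assumes "0 \<le> t" "0 < l" "1 \<le> p"
  shows "t \<le> l + l powr (1 - p) * t powr p"
proof (cases "t \<le> l")
  case True
  moreover have "0 \<le> l powr (1 - p) * t powr p" by simp
  ultimately show ?thesis by linarith
next
  case False
  then have "t = t powr (1 - p) * t powr p"
    using assms by (simp add: powr_add[symmetric])
  also have "\<dots> \<le> l powr (1 - p) * t powr p"
    using assms False by (intro mult_right_mono powr_mono2') auto
  finally show ?thesis using assms by linarith
qed

text \<open>The difference of the means is the average of \<open>w x - w y\<close> over
  \<open>S \<times> T\<close>. Splitting its absolute value at the level \<open>l\<close> leaves a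
  \<open>p\<close>-th power, which is at most \<open>\<rho> powr (DIM('a) + r * p)\<close> times the
  Gagliardo integrand.\<close>

lemma mean_difference_bound:
  fixes w :: "'a::euclidean_space \<Rightarrow> real"
  assumes w: "continuous_on UNIV w"
    and S: "compact S" "0 < measure lborel S" and T: "compact T" "0 < measure lborel T"
    and p: "1 \<le> p" and rp: "0 \<le> real DIM('a) + r * p" and l: "0 < l" and M: "0 \<le> M"
    and \<rho>: "\<And>x y. x \<in> S \<Longrightarrow> y \<in> T \<Longrightarrow> norm (x - y) \<le> \<rho>"
    and bound: "(\<integral>\<^sup>+z. indicator (S \<times> T) z * ennreal (gagliardo_integrand r p w z) \<partial>lborel) \<le> ennreal M"
  shows "\<bar>(LINT x:S|lborel. w x) / measure lborel S - (LINT x:T|lborel. w x) / measure lborel T\<bar>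
     \<le> l + l powr (1 - p) * \<rho> powr (real DIM('a) + r * p) * M / (measure lborel S * measure lborel T)"
proof -
  define \<gamma> where "\<gamma> = real DIM('a) + r * p"
  define a where "a = measure lborel S"
  define b where "b = measure lborel T"
  define F where "F z = indicator (S \<times> T) z *\<^sub>R (w (fst z) - w (snd z))" for z :: "'a \<times> 'a"
  have wm: "w \<in> borel_measurable borel"
    using w by (rule borel_measurable_continuous_onI)
  have fin: "emeasure lborel S < \<infinity>" "emeasure lborel T < \<infinity>"
    using S T emeasure_bounded_finite[OF compact_imp_bounded] by auto
  have [measurable]: "S \<in> sets borel" "T \<in> sets borel"
    using S T by (auto intro: borel_compact)
  have ST: "S \<times> T \<in> sets borel"
    using S T by (intro borel_compact compact_Times)
  have cont: "continuous_on (S \<times> T) (\<lambda>z. w (fst z) - w (snd z))"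
    by (intro continuous_on_diff continuous_on_compose2[OF w] continuous_intros) auto
  have Fi: "integrable lborel F"
    unfolding F_def using S T by (intro borel_integrable_compact compact_Times cont)
  have Si: "integrable lborel (\<lambda>x. indicator S x *\<^sub>R w x)"
    "integrable lborel (\<lambda>x. indicator T x *\<^sub>R w x)"
    by (intro borel_integrable_compact S T continuous_on_subset[OF w] subset_UNIV)+
  have i1: "integrable lborel (indicator S :: 'a \<Rightarrow> real)" "integrable lborel (indicator T :: 'a \<Rightarrow> real)"
    using fin by (auto simp: integrable_indicator_iff)
  define IS where "IS = (LINT x:S|lborel. w x)"
  define IT where "IT = (LINT x:T|lborel. w x)"
  have "(\<integral>z. F z \<partial>lborel) = (\<integral>x. (\<integral>y. F (x, y) \<partial>lborel) \<partial>lborel)"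
    using lborel_pair.integral_fst'[of F] Fi by (simp add: lborel_prod)
  also have "\<dots> = (\<integral>x. b * (indicator S x *\<^sub>R w x) - indicator S x * IT \<partial>lborel)"
  proof (rule Bochner_Integration.integral_cong[OF refl])
    fix x
    have "(\<integral>y. F (x, y) \<partial>lborel) =
        (\<integral>y. (indicator S x * w x) * indicator T y - indicator S x * (indicator T y *\<^sub>R w y) \<partial>lborel)"
      by (intro Bochner_Integration.integral_cong) (auto simp: F_def indicator_def)
    also have "\<dots> = (indicator S x * w x) * b - indicator S x * IT"
      using Si i1 by (simp add: b_def IT_def set_lebesgue_integral_def)
    finally show "(\<integral>y. F (x, y) \<partial>lborel) = b * (indicator S x *\<^sub>R w x) - indicator S x * IT"
      by simp
  qed
  also have "\<dots> = b * IS - a * IT"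
    using Si i1 by (simp add: a_def IS_def set_lebesgue_integral_def)
  finally have IF: "(\<integral>z. F z \<partial>lborel) = b * IS - a * IT" .
  let ?c = "l powr (1 - p) * \<rho> powr \<gamma>"
  have pt: "ennreal \<bar>F z\<bar> \<le> ennreal l * indicator (S \<times> T) z +
      ennreal ?c * (indicator (S \<times> T) z * ennreal (gagliardo_integrand r p w z))" for z
  proof (cases "z \<in> S \<times> T")
    case True
    let ?t = "\<bar>w (fst z) - w (snd z)\<bar>" and ?n = "norm (fst z - snd z)"
    have "?t powr p \<le> \<rho> powr \<gamma> * gagliardo_integrand r p w z"
    proof (cases "?n = 0")
      case True
      then show ?thesis using p by simp
    next
      case False
      have "?t powr p = ?n powr \<gamma> * gagliardo_integrand r p w z"
        using False by (simp add: gagliardo_integrand_def \<gamma>_def)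
      also have "\<dots> \<le> \<rho> powr \<gamma> * gagliardo_integrand r p w z"
        using True \<rho> rp by (intro mult_right_mono powr_mono2) (auto simp: \<gamma>_def)
      finally show ?thesis .
    qed
    then have "l + l powr (1 - p) * ?t powr p \<le> l + ?c * gagliardo_integrand r p w z"
      by (simp add: mult_left_mono mult.assoc)
    then have "?t \<le> l + ?c * gagliardo_integrand r p w z"
      using le_plus_powr[of ?t l p] l p by (meson abs_ge_zero order_trans)
    then have "ennreal ?t \<le> ennreal (l + ?c * gagliardo_integrand r p w z)"
      by (rule ennreal_leI)
    also have "\<dots> = ennreal l + ennreal ?c * ennreal (gagliardo_integrand r p w z)"
      using l by (simp add: ennreal_mult')
    finally show ?thesis
      using True by (simp add: F_def)
  qed (simp add: F_def)
  have gm: "(\<lambda>z. indicator (S \<times> T) z * ennreal (gagliardo_integrand r p w z)) \<in> borel_measurable borel"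
    using ST borel_measurable_gagliardo_integrand[OF wm]
    by (intro borel_measurable_times_ennreal borel_measurable_indicator measurable_compose[OF _ measurable_ennreal]) auto
  have em: "emeasure lborel (S \<times> T) = ennreal (a * b)"
  proof -
    have "emeasure lborel (S \<times> T) = emeasure lborel S * emeasure lborel T"
      using lborel.emeasure_pair_measure_Times[of S lborel T] by (simp add: lborel_prod)
    then show ?thesis
      using fin by (simp add: a_def b_def emeasure_eq_ennreal_measure ennreal_mult' less_top)
  qed
  have "ennreal (\<integral>z. \<bar>F z\<bar> \<partial>lborel) = (\<integral>\<^sup>+z. ennreal \<bar>F z\<bar> \<partial>lborel)"
    using Fi by (intro nn_integral_eq_integral[symmetric]) auto
  also have "\<dots> \<le> (\<integral>\<^sup>+z. (ennreal l * indicator (S \<times> T) z +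
      ennreal ?c * (indicator (S \<times> T) z * ennreal (gagliardo_integrand r p w z))) \<partial>lborel)"
    by (intro nn_integral_mono pt)
  also have "\<dots> = ennreal l * emeasure lborel (S \<times> T) +
      ennreal ?c * (\<integral>\<^sup>+z. indicator (S \<times> T) z * ennreal (gagliardo_integrand r p w z) \<partial>lborel)"
    using gm ST
    by (subst nn_integral_add) (auto simp: nn_integral_cmult_indicator nn_integral_cmult)
  also have "\<dots> \<le> ennreal l * ennreal (a * b) + ennreal ?c * ennreal M"
    using bound by (intro add_mono mult_left_mono) (auto simp: em)
  also have "\<dots> = ennreal (l * (a * b) + ?c * M)"
    using l M by (simp add: ennreal_mult' a_def b_def)
  finally have "(\<integral>z. \<bar>F z\<bar> \<partial>lborel) \<le> l * (a * b) + ?c * M"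
    using l M by (subst (asm) ennreal_le_iff) (auto simp: a_def b_def)
  with integral_abs_bound[of lborel F] have *: "\<bar>b * IS - a * IT\<bar> \<le> l * (a * b) + ?c * M"
    by (simp add: IF)
  have ab: "0 < a" "0 < b" using S T by (auto simp: a_def b_def)
  have "\<bar>IS / a - IT / b\<bar> = \<bar>b * IS - a * IT\<bar> / (a * b)"
    using ab by (simp add: diff_frac_eq abs_divide mult.commute abs_mult)
  also have "\<dots> \<le> (l * (a * b) + ?c * M) / (a * b)"
    using * ab by (intro divide_right_mono) auto
  also have "\<dots> = l + ?c * M / (a * b)"
    using ab by (simp add: add_divide_distrib)
  finally show ?thesis
    by (simp add: a_def b_def IS_def IT_def \<gamma>_def)
qed

definition cball_mean :: "('a::euclidean_space \<Rightarrow> real) \<Rightarrow> 'a \<Rightarrow> real \<Rightarrow> real" where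
  "cball_mean w x d = (LINT y:cball x d|lborel. w y) / measure lborel (cball x d)"

text \<open>The level \<open>l = M powr (1/p) * d powr (r - DIM('a) / p)\<close> balances the two
  terms: then \<open>l powr p = M * d powr (r * p - DIM('a))\<close>, and the second term is a
  constant times \<open>l\<close>. The range of \<open>d'\<close> admits both the halved concentric
  ball and an equal ball about a nearby centre; the bound \<open>d' \<ge> d / 2\<close> costs the
  factor \<open>2 ^ DIM('a)\<close>.\<close>

lemma cball_mean_difference_bound:
  fixes w :: "'a::euclidean_space \<Rightarrow> real"
  assumes w: "continuous_on UNIV w" and p: "1 \<le> p" and r: "0 < r"
    and d: "0 < d" "d / 2 \<le> d'" "d' \<le> d" and xy: "dist x y \<le> d" and M: "0 < M"
    and bound: "(\<integral>\<^sup>+z. indicator (cball x d \<times> cball y d') z * ennreal (gagliardo_integrand r p w z) \<partial>lborel) \<le> ennreal M"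
  shows "\<bar>cball_mean w x d - cball_mean w y d'\<bar> \<le>
    (1 + 3 powr (real DIM('a) + r * p) * 2 ^ DIM('a) / (unit_ball_vol DIM('a))\<^sup>2) *
    (M powr (1 / p) * d powr (r - real DIM('a) / p))"
proof -
  define N where "N = real DIM('a)"
  define \<omega> where "\<omega> = unit_ball_vol (real DIM('a))"
  define l where "l = M powr (1 / p) * d powr (r - N / p)"
  have \<omega>: "0 < \<omega>" by (simp add: \<omega>_def)
  have l: "0 < l" using M d by (simp add: l_def)
  have rp: "0 \<le> N + r * p" using r p by (simp add: N_def)
  \<comment> \<open>The path from \<open>a\<close> through \<open>x\<close> and \<open>y\<close> to
    \<open>b\<close> has three legs of length at most \<open>d\<close>; hence the base 3 in the
    constant.\<close>
  have \<rho>: "norm (a - b) \<le> 3 * d" if "a \<in> cball x d" "b \<in> cball y d'" for a b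
    using that xy d dist_triangle[of a b x] dist_triangle[of x b y]
    by (simp add: dist_norm[symmetric] dist_commute)
  have m: "measure lborel (cball x d) = \<omega> * d ^ DIM('a)" "measure lborel (cball y d') = \<omega> * d' ^ DIM('a)"
    using d by (simp_all add: content_cball \<omega>_def)
  have "\<bar>cball_mean w x d - cball_mean w y d'\<bar> \<le>
      l + l powr (1 - p) * (3 * d) powr (N + r * p) * M / (measure lborel (cball x d) * measure lborel (cball y d'))"
    unfolding cball_mean_def N_def
    using d M rp by (intro mean_difference_bound w p l \<rho> bound) (auto simp: N_def)
  also have "\<dots> \<le> l + l powr (1 - p) * (3 * d) powr (N + r * p) * M / (\<omega>\<^sup>2 * d powr (2 * N) / 2 ^ DIM('a))"
  proof -
    have "(d / 2) ^ DIM('a) \<le> d' ^ DIM('a)"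
      using d by (intro power_mono) auto
    then have "(\<omega> * d ^ DIM('a)) * (\<omega> * (d / 2) ^ DIM('a)) \<le> (\<omega> * d ^ DIM('a)) * (\<omega> * d' ^ DIM('a))"
      using \<omega> d by (intro mult_left_mono) auto
    moreover have "(\<omega> * d ^ DIM('a)) * (\<omega> * (d / 2) ^ DIM('a)) = \<omega>\<^sup>2 * d powr (2 * N) / 2 ^ DIM('a)"
    proof -
      have "d powr (2 * N) = d ^ DIM('a) * d ^ DIM('a)"
        using d powr_add[of d N N] powr_realpow[of d "DIM('a)"] by (simp add: N_def)
      then show ?thesis by (simp add: power_divide power2_eq_square)
    qed
    ultimately have "\<omega>\<^sup>2 * d powr (2 * N) / 2 ^ DIM('a) \<le> measure lborel (cball x d) * measure lborel (cball y d')"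
      unfolding m by simp
    moreover have "0 < \<omega>\<^sup>2 * d powr (2 * N) / 2 ^ DIM('a)"
      using \<omega> d by simp
    ultimately show ?thesis
      using M by (intro add_left_mono frac_le order_refl mult_nonneg_nonneg) auto
  qed
  also have "l powr (1 - p) * (3 * d) powr (N + r * p) * M / (\<omega>\<^sup>2 * d powr (2 * N) / 2 ^ DIM('a)) =
      3 powr (N + r * p) * 2 ^ DIM('a) / \<omega>\<^sup>2 * l"
  proof -
    have "l powr p = M * d powr (r * p - N)"
      using M d p by (simp add: l_def powr_mult powr_powr left_diff_distrib)
    then have "l powr (1 - p) = l / (M * d powr (r * p - N))"
      using l by (simp add: powr_diff)
    moreover have "(3 * d) powr (N + r * p) = 3 powr (N + r * p) * (d powr (2 * N) * d powr (r * p - N))"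
      using d by (simp add: powr_mult powr_add[symmetric])
    ultimately show ?thesis
      using M d by simp
  qed
  finally show ?thesis
    by (simp add: l_def N_def \<omega>_def algebra_simps)
qed

lemma cball_mean_close:
  fixes w :: "'a::euclidean_space \<Rightarrow> real"
  assumes w: "continuous_on UNIV w" and d: "0 < d" and e: "\<And>y. y \<in> cball x d \<Longrightarrow> \<bar>w y - c\<bar> \<le> e"
  shows "\<bar>cball_mean w x d - c\<bar> \<le> e"
proof -
  have i: "integrable lborel (\<lambda>y. indicator (cball x d) y *\<^sub>R w y)"
    by (intro borel_integrable_compact compact_cball continuous_on_subset[OF w] subset_UNIV)
  have fin: "emeasure lborel (cball x d) < \<infinity>"
    using emeasure_bounded_finite[of "cball x d"] by simp
  have i1: "integrable lborel (indicator (cball x d) :: 'a \<Rightarrow> real)"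
    using fin by (auto simp: integrable_indicator_iff)
  define m where "m = measure lborel (cball x d)"
  have m: "0 < m" using d by (simp add: m_def)
  have I: "(\<integral>y. indicator (cball x d) y * k \<partial>lborel) = m * k" for k :: real
    using i1 by (simp add: m_def)
  have "(\<integral>y. indicator (cball x d) y * (c - e) \<partial>lborel) \<le> (LINT y:cball x d|lborel. w y)"
    unfolding set_lebesgue_integral_def
  proof (rule integral_mono)
    fix y show "indicator (cball x d) y * (c - e) \<le> indicator (cball x d) y *\<^sub>R w y"
      using e[of y] by (cases "y \<in> cball x d") (auto simp: abs_le_iff)
  qed (use i i1 in auto)
  moreover have "(LINT y:cball x d|lborel. w y) \<le> (\<integral>y. indicator (cball x d) y * (c + e) \<partial>lborel)"
    unfolding set_lebesgue_integral_def
  proof (rule integral_mono)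
    fix y show "indicator (cball x d) y *\<^sub>R w y \<le> indicator (cball x d) y * (c + e)"
      using e[of y] by (cases "y \<in> cball x d") (auto simp: abs_le_iff)
  qed (use i i1 in auto)
  ultimately have "m * (c - e) \<le> (LINT y:cball x d|lborel. w y)" "(LINT y:cball x d|lborel. w y) \<le> m * (c + e)"
    unfolding I by auto
  then have "c - e \<le> cball_mean w x d" "cball_mean w x d \<le> c + e"
    using m by (simp_all add: cball_mean_def m_def[symmetric] field_simps)
  then show ?thesis by (simp add: abs_le_iff)
qed

text \<open>Telescoping over the radii \<open>d / 2 ^ k\<close>: the \<open>k\<close>-th difference
  of means carries the factor \<open>q ^ k\<close> with
  \<open>q = (1/2) powr (r - DIM('a) / p)\<close>, and \<open>q < 1\<close> because
  \<open>r p\<close> exceeds the dimension. The geometric series gives the factor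
  \<open>1 / (1 - q)\<close>.\<close>

lemma cball_mean_center_bound:
  fixes w :: "'a::euclidean_space \<Rightarrow> real"
  assumes w: "continuous_on UNIV w" and p: "1 \<le> p" and r: "0 < r" and rp: "real DIM('a) < r * p"
    and d: "0 < d" and M: "0 < M" and D: "cball x d \<subseteq> D"
    and bound: "(\<integral>\<^sup>+z. indicator (D \<times> D) z * ennreal (gagliardo_integrand r p w z) \<partial>lborel) \<le> ennreal M"
    and C: "C = 1 + 3 powr (real DIM('a) + r * p) * 2 ^ DIM('a) / (unit_ball_vol DIM('a))\<^sup>2"
  shows "\<bar>w x - cball_mean w x d\<bar> \<le>
    C / (1 - (1/2) powr (r - real DIM('a) / p)) * (M powr (1 / p) * d powr (r - real DIM('a) / p))"
proof -
  define \<sigma> where "\<sigma> = r - real DIM('a) / p"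
  define q where "q = (1/2::real) powr \<sigma>"
  define K where "K = M powr (1 / p) * d powr \<sigma>"
  have \<sigma>: "0 < \<sigma>" using rp p by (simp add: \<sigma>_def field_simps)
  have q: "0 < q" "q < 1"
    using \<sigma> powr_less_mono'[of "1/2" 0 \<sigma>] by (simp_all add: q_def)
  have C0: "0 < C" unfolding C by (intro add_pos_nonneg) auto
  have K0: "0 \<le> K" by (simp add: K_def)
  have step: "\<bar>cball_mean w x (d / 2 ^ k) - cball_mean w x (d / 2 ^ Suc k)\<bar> \<le> C * K * q ^ k" for k
  proof -
    have dk: "d / 2 ^ k \<le> d" using d by (simp add: field_simps)
    have sub: "cball x (d / 2 ^ k) \<times> cball x (d / 2 ^ Suc k) \<subseteq> D \<times> D"
    proof -
      have "cball x (d / 2 ^ k) \<subseteq> cball x d" "cball x (d / 2 ^ Suc k) \<subseteq> cball x d"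
        using dk d by (auto intro!: subset_cball simp: field_simps intro: order_trans[OF _ dk])
      then show ?thesis using D by blast
    qed
    have "\<bar>cball_mean w x (d / 2 ^ k) - cball_mean w x (d / 2 ^ Suc k)\<bar> \<le>
       C * (M powr (1 / p) * (d / 2 ^ k) powr (r - real DIM('a) / p))"
      unfolding C
    proof (rule cball_mean_difference_bound[OF w p r])
      show "(\<integral>\<^sup>+z. indicator (cball x (d / 2 ^ k) \<times> cball x (d / 2 ^ Suc k)) z *
          ennreal (gagliardo_integrand r p w z) \<partial>lborel) \<le> ennreal M"
        using sub by (intro order_trans[OF _ bound] nn_integral_mono mult_right_mono)
           (auto simp: indicator_def)
    qed (use d M in \<open>auto simp: field_simps\<close>)
    also have "(d / 2 ^ k) powr (r - real DIM('a) / p) = d powr \<sigma> * q ^ k"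
    proof -
      have "q ^ k = (1/2) powr (\<sigma> * real k)"
        using q by (simp add: q_def powr_powr[symmetric] powr_realpow[symmetric])
      also have "\<dots> = ((1/2) ^ k) powr \<sigma>"
        by (simp add: powr_realpow[symmetric] powr_powr mult.commute)
      finally show ?thesis
        using d by (simp add: \<sigma>_def[symmetric] powr_mult[symmetric] power_one_over field_simps)
    qed
    finally show ?thesis by (simp add: K_def mult.assoc)
  qed
  have tel: "\<bar>cball_mean w x d - cball_mean w x (d / 2 ^ n)\<bar> \<le> C * K * (\<Sum>k<n. q ^ k)" for n
  proof (induction n)
    case (Suc n)
    show ?case using Suc.IH step[of n] by (simp add: distrib_left)
  qed simp
  have geo: "(\<Sum>k<n. q ^ k) \<le> 1 / (1 - q)" for n
    using q by (simp add: sum_gp_strict divide_right_mono)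
  have tel': "\<bar>cball_mean w x d - cball_mean w x (d / 2 ^ n)\<bar> \<le> C * K / (1 - q)" for n
    using order_trans[OF tel[of n] mult_left_mono[OF geo[of n], of "C * K"]] C0 K0 by simp
  \<comment> \<open>Continuity at \<open>x\<close> enters here: the mean over a small enough ball is
    within \<open>e\<close> of \<open>w x\<close>, while the telescoped bound is uniform in the
    number of halvings.\<close>
  have "\<bar>w x - cball_mean w x d\<bar> \<le> C * K / (1 - q) + e" if "0 < e" for e
  proof -
    have "isCont w x" using w by (simp add: continuous_on_eq_continuous_at)
    then obtain \<delta> where \<delta>: "0 < \<delta>" "\<And>y. dist y x < \<delta> \<Longrightarrow> dist (w y) (w x) < e"
      using \<open>0 < e\<close> unfolding continuous_at_eps_delta by (auto simp: dist_norm)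
    obtain n where n: "d / 2 ^ n < \<delta>"
    proof -
      obtain n where "(1/2) ^ n < \<delta> / d"
        using real_arch_pow_inv[of "\<delta> / d" "1/2"] \<delta> d by auto
      then show ?thesis using that[of n] d by (simp add: field_simps power_one_over)
    qed
    have "\<bar>cball_mean w x (d / 2 ^ n) - w x\<bar> \<le> e"
    proof (rule cball_mean_close[OF w])
      fix y assume "y \<in> cball x (d / 2 ^ n)"
      then have "dist y x < \<delta>" using n by (simp add: dist_commute)
      then show "\<bar>w y - w x\<bar> \<le> e" using \<delta>(2)[of y] by (simp add: dist_real_def)
    qed (use d in simp)
    then show ?thesis using tel'[of n] by linarith
  qed
  then have "\<bar>w x - cball_mean w x d\<bar> \<le> C * K / (1 - q)"
    by (rule field_le_epsilon)
  then show ?thesis by (simp add: K_def q_def \<sigma>_def)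
qed

text \<open>The first factor compares two ball means. It is counted once for the passage between the
  two centres and \<open>1 / (1 - q)\<close> times for each of the two passages from a point to its
  mean.\<close>

definition morrey_const :: "'a::euclidean_space itself \<Rightarrow> real \<Rightarrow> real \<Rightarrow> real" where
  "morrey_const _ r p =
     (1 + 3 powr (real DIM('a) + r * p) * 2 ^ DIM('a) / (unit_ball_vol DIM('a))\<^sup>2) *
     (1 + 2 / (1 - (1/2) powr (r - real DIM('a) / p)))"

text \<open>The chain runs from \<open>w x\<close> to the means over the balls of radius
  \<open>dist x y\<close> about \<open>x\<close> and about \<open>y\<close>, then to
  \<open>w y\<close>. All pairs involved lie in \<open>D \<times> D\<close>, so a local energy
  suffices. \<open>M\<close> is any positive bound, so for vanishing energy it may be taken
  arbitrarily small.\<close>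

lemma fractional_morrey:
  fixes w :: "'a::euclidean_space \<Rightarrow> real"
  assumes w: "continuous_on UNIV w" and p: "1 \<le> p" and r: "0 < r" and rp: "real DIM('a) < r * p"
    and M: "0 < M" and D: "cball x (dist x y) \<subseteq> D" "cball y (dist x y) \<subseteq> D"
    and bound: "(\<integral>\<^sup>+z. indicator (D \<times> D) z * ennreal (gagliardo_integrand r p w z) \<partial>lborel) \<le> ennreal M"
  shows "\<bar>w x - w y\<bar> \<le> morrey_const TYPE('a) r p * M powr (1 / p) * dist x y powr (r - real DIM('a) / p)"
proof (cases "x = y")
  case False
  define d where "d = dist x y"
  define C where "C = 1 + 3 powr (real DIM('a) + r * p) * 2 ^ DIM('a) / (unit_ball_vol DIM('a))\<^sup>2"
  define Q where "Q = 1 - (1/2::real) powr (r - real DIM('a) / p)"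
  define K where "K = M powr (1 / p) * d powr (r - real DIM('a) / p)"
  have d: "0 < d" using False by (simp add: d_def)
  have "\<bar>w x - cball_mean w x d\<bar> \<le> C / Q * K" "\<bar>w y - cball_mean w y d\<bar> \<le> C / Q * K"
    unfolding Q_def K_def using D
    by (intro cball_mean_center_bound[OF w p r rp d M _ bound C_def]; simp add: d_def)+
  moreover have "\<bar>cball_mean w x d - cball_mean w y d\<bar> \<le> C * K"
    unfolding C_def K_def
  proof (rule cball_mean_difference_bound[OF w p r d])
    show "(\<integral>\<^sup>+z. indicator (cball x d \<times> cball y d) z * ennreal (gagliardo_integrand r p w z) \<partial>lborel) \<le> ennreal M"
      using D by (intro order_trans[OF _ bound] nn_integral_mono mult_right_mono)
         (auto simp: indicator_def d_def)
  qed (use d M in \<open>auto simp: d_def\<close>)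
  ultimately have "\<bar>w x - w y\<bar> \<le> C * K + 2 * (C / Q * K)"
    by linarith
  also have "\<dots> = C * (1 + 2 / Q) * K"
    by (simp add: algebra_simps)
  finally show ?thesis
    by (simp add: morrey_const_def C_def Q_def K_def d_def mult.assoc)
qed simp

section \<open>Pointwise inequalities\<close>

text \<open>Only the origin is delicate: there the absolute value of the difference quotient is
  \<open>\<bar>h\<bar> powr (p - 1)\<close>, which tends to 0 since \<open>p > 1\<close>.\<close>

lemma has_real_derivative_abs_powr:
  fixes x p :: real
  assumes "1 < p"
  shows "((\<lambda>x. \<bar>x\<bar> powr p) has_real_derivative p * (sgn x * \<bar>x\<bar> powr (p - 1))) (at x)"
proof (cases x "0::real" rule: linorder_cases)
  case less
  have "((\<lambda>x. (- x) powr p) has_real_derivative - (p * (- x) powr (p - 1))) (at x)"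
    using less by (auto intro!: derivative_eq_intros)
  then have "((\<lambda>x. \<bar>x\<bar> powr p) has_real_derivative - (p * (- x) powr (p - 1))) (at x)"
    by (rule has_field_derivative_transform_within_open[where S = "{..<0}"]) (use less in auto)
  then show ?thesis using less by simp
next
  case equal
  have "((\<lambda>h. \<bar>h\<bar> powr p / h) \<longlongrightarrow> 0) (at (0::real))"
  proof (rule tendsto_rabs_zero_cancel, rule Lim_transform_eventually)
    have "((\<lambda>h. \<bar>h\<bar> powr (p - 1)) \<longlongrightarrow> \<bar>0::real\<bar> powr (p - 1)) (at 0)"
      using assms by (intro tendsto_powr2 tendsto_intros) auto
    then show "((\<lambda>h. \<bar>h\<bar> powr (p - 1)) \<longlongrightarrow> 0) (at (0::real))"
      by simp
    show "\<forall>\<^sub>F h::real in at 0. \<bar>h\<bar> powr (p - 1) = \<bar>\<bar>h\<bar> powr p / h\<bar>"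
      by (auto simp: eventually_at powr_diff abs_divide intro!: exI[of _ 1])
  qed
  then show ?thesis
    using equal by (simp add: has_field_derivative_iff)
next
  case greater
  have "((\<lambda>x. x powr p) has_real_derivative (p * x powr (p - 1))) (at x)"
    using greater by (auto intro!: derivative_eq_intros)
  then have "((\<lambda>x. \<bar>x\<bar> powr p) has_real_derivative (p * x powr (p - 1))) (at x)"
    by (rule has_field_derivative_transform_within_open[where S = "{0<..}"]) (use greater in auto)
  then show ?thesis using greater by simp
qed

lemma abs_powr_diff_bound:
  fixes a b p :: real
  assumes p: "1 < p"
  shows "\<bar>\<bar>a + b\<bar> powr p - \<bar>a\<bar> powr p\<bar> \<le> p * (\<bar>a\<bar> + \<bar>b\<bar>) powr (p - 1) * \<bar>b\<bar>"
proof -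
  let ?f = "\<lambda>t. \<bar>a + t * b\<bar> powr p"
  let ?f' = "\<lambda>t. p * (sgn (a + t * b) * \<bar>a + t * b\<bar> powr (p - 1)) * b"
  have "(?f has_real_derivative ?f' t) (at t)" for t
    by (rule DERIV_chain2[OF has_real_derivative_abs_powr[OF p], of _ b])
      (auto intro!: derivative_eq_intros)
  then obtain t where t: "0 < t" "t < 1" "?f 1 - ?f 0 = (1 - 0) * ?f' t"
    using MVT2[of 0 1 ?f ?f'] by auto
  have "\<bar>a + t * b\<bar> \<le> \<bar>a\<bar> + \<bar>b\<bar>"
    using t mult_left_le_one_le[of "\<bar>b\<bar>" t] abs_triangle_ineq[of a "t * b"] by (simp add: abs_mult)
  then have "\<bar>a + t * b\<bar> powr (p - 1) \<le> (\<bar>a\<bar> + \<bar>b\<bar>) powr (p - 1)"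
    using p by (intro powr_mono2) auto
  then have "\<bar>sgn (a + t * b)\<bar> * \<bar>a + t * b\<bar> powr (p - 1) \<le> 1 * (\<bar>a\<bar> + \<bar>b\<bar>) powr (p - 1)"
    by (intro mult_mono) (auto simp: sgn_if)
  then have "\<bar>?f' t\<bar> \<le> p * (\<bar>a\<bar> + \<bar>b\<bar>) powr (p - 1) * \<bar>b\<bar>"
    using p by (simp add: abs_mult mult_right_mono mult_left_mono)
  then show ?thesis using t by simp
qed

lemma sum_powr_bound:
  fixes a b p :: real
  assumes "0 \<le> p" "0 \<le> a" "0 \<le> b"
  shows "(a + b) powr p \<le> 2 powr p * (a powr p + b powr p)"
proof -
  have "(a + b) powr p \<le> (2 * max a b) powr p"
    using assms by (intro powr_mono2) auto
  also have "\<dots> = 2 powr p * max a b powr p"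
    using assms by (simp add: powr_mult)
  also have "max a b powr p \<le> a powr p + b powr p"
    by (simp add: max_def)
  finally show ?thesis by simp
qed

text \<open>Uniform in \<open>h\<close>; divided by the kernel, the right side is a multiple of the
  sum of two Gagliardo integrands. This is the dominating function for the first variation.\<close>

lemma abs_powr_quotient_bound:
  fixes a b h p :: real
  assumes p: "1 < p" and h: "0 < h" "h \<le> 1"
  shows "\<bar>(\<bar>a + h * b\<bar> powr p - \<bar>a\<bar> powr p) / h\<bar> \<le> p * 2 powr p * (\<bar>a\<bar> powr p + \<bar>b\<bar> powr p)"
proof -
  have hb: "\<bar>h * b\<bar> \<le> \<bar>b\<bar>"
    using h by (simp add: abs_mult mult_left_le_one_le)
  have "\<bar>\<bar>a + h * b\<bar> powr p - \<bar>a\<bar> powr p\<bar> \<le> p * (\<bar>a\<bar> + \<bar>h * b\<bar>) powr (p - 1) * \<bar>h * b\<bar>"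
    by (rule abs_powr_diff_bound[OF p])
  also have "\<dots> \<le> p * (\<bar>a\<bar> + \<bar>b\<bar>) powr (p - 1) * \<bar>h * b\<bar>"
    using p hb by (intro mult_right_mono mult_left_mono powr_mono2) auto
  finally have "\<bar>(\<bar>a + h * b\<bar> powr p - \<bar>a\<bar> powr p) / h\<bar> \<le> p * (\<bar>a\<bar> + \<bar>b\<bar>) powr (p - 1) * \<bar>b\<bar>"
    using h by (simp add: abs_mult field_simps)
  also have "\<dots> \<le> p * (\<bar>a\<bar> + \<bar>b\<bar>) powr (p - 1) * (\<bar>a\<bar> + \<bar>b\<bar>)"
    using p by (intro mult_left_mono) auto
  also have "\<dots> = p * (\<bar>a\<bar> + \<bar>b\<bar>) powr p"
    by (cases "\<bar>a\<bar> + \<bar>b\<bar> = 0") (auto simp: powr_diff)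
  also have "\<dots> \<le> p * (2 powr p * (\<bar>a\<bar> powr p + \<bar>b\<bar> powr p))"
    using p by (intro mult_left_mono sum_powr_bound) auto
  finally show ?thesis by simp
qed

text \<open>For \<open>s > t\<close> this is convexity of the \<open>p\<close>-th power:
  \<open>s\<close> is the convex combination of \<open>X\<close> and \<open>Y\<close> with weights
  \<open>c / a\<close> and \<open>b / a\<close>, whose sum is 1. For \<open>s \<le> t\<close> the
  left side is not positive.\<close>

lemma discrete_picone_less:
  fixes a b s t p :: real
  assumes p: "1 < p" and b: "0 < b" and ab: "b < a" and s: "0 \<le> s" and t: "0 \<le> t"
  shows "(a - b) powr (p - 1) * (s powr p * a powr (1 - p) - t powr p * b powr (1 - p)) \<le> \<bar>s - t\<bar> powr p"
proof (cases "s \<le> t")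
  case True
  have "s powr p * a powr (1 - p) \<le> t powr p * b powr (1 - p)"
    using True assms by (intro mult_mono powr_mono2 powr_mono2') auto
  then have "(a - b) powr (p - 1) * (s powr p * a powr (1 - p) - t powr p * b powr (1 - p)) \<le> 0"
    by (intro mult_nonneg_nonpos) auto
  then show ?thesis by (rule order_trans) simp
next
  case False
  define c where "c = a - b"
  define X where "X = (s - t) * a / c"
  define Y where "Y = t * a / b"
  have a: "0 < a" and c: "0 < c" "c < a" using ab b by (auto simp: c_def)
  have X: "0 < X" using False a c by (simp add: X_def)
  have sXY: "s = (c / a) * X + (b / a) * Y"
    using a b c by (simp add: X_def Y_def)
  \<comment> \<open>For \<open>t = 0\<close> the point \<open>Y\<close> is zero, and
    \<open>(c / a) powr p \<le> c / a\<close> gives the bound directly.\<close>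
  have key: "s powr p \<le> (c / a) * X powr p + (b / a) * Y powr p"
  proof (cases "t = 0")
    case True
    have "s powr p = (c / a) powr p * X powr p"
      using sXY True a c X powr_mult[of "c / a" X p] by (simp add: Y_def)
    also have "\<dots> \<le> (c / a) powr 1 * X powr p"
      using p a c by (intro mult_right_mono powr_mono') auto
    finally show ?thesis using a c by (simp add: True Y_def)
  next
    case False
    then have Y: "0 < Y" using t a b by (simp add: Y_def)
    have "((b / a) * Y + (c / a) * X) powr p \<le> (b / a) * Y powr p + (c / a) * X powr p"
    proof -
      have "1 - c / a = b / a" "0 \<le> c / a" "c / a \<le> 1"
        using a b c by (auto simp: c_def diff_divide_distrib)
      then show ?thesis
        using convex_onD[OF powr_convex[of p], of "c / a" Y X] X Y p by simp
    qed
    then show ?thesis using sXY by (simp add: add.commute)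
  qed
  have e1: "(c / a) * X powr p = (s - t) powr p * (c powr (1 - p) * a powr (p - 1))"
    using False a c by (simp add: X_def powr_mult powr_divide powr_diff mult_ac)
  have e2: "(b / a) * Y powr p = t powr p * (b powr (1 - p) * a powr (p - 1))"
    using t a b by (simp add: Y_def powr_mult powr_divide powr_diff mult_ac)
  have inv: "a powr (p - 1) * a powr (1 - p) = 1" "c powr (p - 1) * c powr (1 - p) = 1"
    using a c by (simp_all add: powr_add[symmetric])
  \<comment> \<open>Multiplication by \<open>(c / a) powr (p - 1)\<close> turns the coefficient of
    \<open>(s - t) powr p\<close> into 1.\<close>
  have "s powr p * (c powr (p - 1) * a powr (1 - p)) \<le>
     ((s - t) powr p * (c powr (1 - p) * a powr (p - 1)) +
      t powr p * (b powr (1 - p) * a powr (p - 1))) * (c powr (p - 1) * a powr (1 - p))"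
    using key unfolding e1 e2 by (intro mult_right_mono) auto
  also have "\<dots> = (s - t) powr p * ((c powr (p - 1) * c powr (1 - p)) * (a powr (p - 1) * a powr (1 - p))) +
      t powr p * b powr (1 - p) * c powr (p - 1) * (a powr (p - 1) * a powr (1 - p))"
    by (simp add: algebra_simps)
  also have "\<dots> = (s - t) powr p + t powr p * b powr (1 - p) * c powr (p - 1)"
    by (simp add: inv)
  finally show ?thesis
    using False by (simp add: c_def algebra_simps)
qed

lemma discrete_picone:
  fixes a b s t p :: real
  assumes "1 < p" "0 < a" "0 < b" "0 \<le> s" "0 \<le> t"
  shows "sgn (a - b) * \<bar>a - b\<bar> powr (p - 1) * (s powr p * a powr (1 - p) - t powr p * b powr (1 - p))
    \<le> \<bar>s - t\<bar> powr p"
proof (cases a b rule: linorder_cases)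
  case less
  then show ?thesis
    using discrete_picone_less[of p a b t s] assms by (simp add: abs_minus_commute algebra_simps)
next
  case greater
  then show ?thesis
    using discrete_picone_less[of p b a s t] assms by simp
qed simp

text \<open>The right side is invariant under scaling and depends only on
  \<open>\<tau> = ln (a / b)\<close>: with \<open>q = p - 1\<close> it is
  \<open>(exp \<tau> - 1) powr q * (1 - exp (- q * \<tau>))\<close>. Lower bounds for the two
  factors are chosen so that \<open>1 + q * \<tau>\<close> cancels in their product, which leaves
  exactly \<open>q * (\<tau> / 2) powr p\<close>.\<close>

lemma discrete_log_inequality_less:
  fixes a b p :: real
  assumes p: "1 < p" and b: "0 < b" and ab: "b < a"
  shows "(p - 1) * (1/2) powr p * (ln a - ln b) powr p \<le> (a - b) powr (p - 1) * (b powr (1 - p) - a powr (1 - p))"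
proof -
  define \<tau> where "\<tau> = ln a - ln b"
  define q where "q = p - 1"
  have q: "0 < q" using p by (simp add: q_def)
  have \<tau>: "0 < \<tau>" using ab b by (simp add: \<tau>_def)
  have a: "a = b * exp \<tau>" using ab b by (simp add: \<tau>_def exp_diff)
  have "(a - b) powr (p - 1) * (b powr (1 - p) - a powr (1 - p)) = (exp \<tau> - 1) powr q * (1 - exp (- (q * \<tau>)))"
  proof -
    have "a - b = b * (exp \<tau> - 1)" using a by (simp add: algebra_simps)
    then have 1: "(a - b) powr (p - 1) = b powr q * (exp \<tau> - 1) powr q"
      using b \<tau> by (simp add: powr_mult q_def)
    have 2: "b powr (1 - p) - a powr (1 - p) = b powr (- q) * (1 - exp (- (q * \<tau>)))"
      using b by (simp add: a powr_mult q_def exp_powr_real algebra_simps)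
    have "b powr q * b powr (- q) = 1" using b by (simp add: powr_add[symmetric])
    then show ?thesis unfolding 1 2 by (metis (no_types, lifting) mult.assoc mult.commute mult.right_neutral)
  qed
  \<comment> \<open>Factoring \<open>exp \<tau> - 1\<close> as a difference of squares in
    \<open>exp (\<tau> / 2)\<close> retains an exponential factor, which is then weakened to the
    linear term needed for the cancellation.\<close>
  moreover have lower: "(\<tau> / 2) powr q * ((1 + q * \<tau>) / 2) \<le> (exp \<tau> - 1) powr q"
  proof -
    have "exp \<tau> - 1 = (exp (\<tau> / 2) - 1) * (exp (\<tau> / 2) + 1)"
      by (simp add: algebra_simps exp_add[symmetric])
    moreover have "(\<tau> / 2) * exp (\<tau> / 2) \<le> (exp (\<tau> / 2) - 1) * (exp (\<tau> / 2) + 1)"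
    proof (rule mult_mono)
      show "\<tau> / 2 \<le> exp (\<tau> / 2) - 1"
        using exp_ge_add_one_self[of "\<tau> / 2"] by linarith
    qed (use \<tau> in auto)
    ultimately have "((\<tau> / 2) * exp (\<tau> / 2)) powr q \<le> (exp \<tau> - 1) powr q"
      using q \<tau> by (intro powr_mono2) auto
    moreover have "((\<tau> / 2) * exp (\<tau> / 2)) powr q = (\<tau> / 2) powr q * exp (q * \<tau> / 2)"
      using \<tau> powr_mult[of "\<tau> / 2" "exp (\<tau> / 2)" q] by (simp add: exp_powr_real mult.commute)
    moreover have "(\<tau> / 2) powr q * ((1 + q * \<tau>) / 2) \<le> (\<tau> / 2) powr q * exp (q * \<tau> / 2)"
    proof (rule mult_left_mono)
      show "(1 + q * \<tau>) / 2 \<le> exp (q * \<tau> / 2)"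
      proof -
        have "(1 + y) / 2 \<le> exp (y / 2)" if "0 < y" for y :: real
        proof -
          have "(1 + y) / 2 \<le> 1 + y / 2" using that by (simp add: field_simps)
          also have "\<dots> \<le> exp (y / 2)" by (rule exp_ge_add_one_self)
          finally show ?thesis .
        qed
        then show ?thesis using mult_pos_pos[OF q \<tau>] by blast
      qed
    qed simp
    ultimately show ?thesis by linarith
  qed
  moreover have "q * \<tau> / (1 + q * \<tau>) \<le> 1 - exp (- (q * \<tau>))"
  proof -
    have y: "0 < q * \<tau>" using q \<tau> by simp
    have "exp (- (q * \<tau>)) \<le> 1 / (1 + q * \<tau>)"
      using y exp_ge_add_one_self[of "q * \<tau>"] by (simp add: exp_minus field_simps)
    then show ?thesis using y by (simp add: field_simps)
  qed
  ultimately have "((\<tau> / 2) powr q * ((1 + q * \<tau>) / 2)) * (q * \<tau> / (1 + q * \<tau>)) \<le>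
     (a - b) powr (p - 1) * (b powr (1 - p) - a powr (1 - p))"
    using mult_mono[OF lower, of "q * \<tau> / (1 + q * \<tau>)"] q \<tau> by simp
  moreover have "((\<tau> / 2) powr q * ((1 + q * \<tau>) / 2)) * (q * \<tau> / (1 + q * \<tau>)) = q * (\<tau> / 2) powr p"
  proof -
    have nz: "1 + q * \<tau> \<noteq> 0" using q \<tau> by (smt (verit) mult_pos_pos)
    have "(\<tau> / 2) powr p = (\<tau> / 2) powr q * (\<tau> / 2)"
      using \<tau> powr_add[of "\<tau> / 2" q 1] by (simp add: q_def)
    then show ?thesis using nz by (simp add: field_simps)
  qed
  moreover have "q * (\<tau> / 2) powr p = (p - 1) * (1/2) powr p * (ln a - ln b) powr p"
    using \<tau> powr_mult[of "1/2" \<tau> p] by (simp add: q_def \<tau>_def)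
  ultimately show ?thesis by simp
qed

lemma discrete_log_inequality:
  fixes a b p :: real
  assumes "1 < p" "0 < a" "0 < b"
  shows "(p - 1) * (1/2) powr p * \<bar>ln a - ln b\<bar> powr p \<le>
    - (sgn (a - b) * \<bar>a - b\<bar> powr (p - 1) * (a powr (1 - p) - b powr (1 - p)))"
proof (cases a b rule: linorder_cases)
  case less
  then show ?thesis
    using discrete_log_inequality_less[of p a b] assms by (simp add: abs_minus_commute algebra_simps)
next
  case greater
  then show ?thesis
    using discrete_log_inequality_less[of p b a] assms by (simp add: algebra_simps)
qed simp

section \<open>First variation of the Gagliardo seminorm\<close>

lemma gagliardo_integrand_cmult:
  "gagliardo_integrand r p (\<lambda>x. c * u x) z = \<bar>c\<bar> powr p * gagliardo_integrand r p u z"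
  by (simp add: gagliardo_integrand_def powr_mult abs_mult right_diff_distrib[symmetric])

lemma gagliardo_pow_cmult:
  fixes u :: "'a::euclidean_space \<Rightarrow> real"
  assumes u: "continuous_on UNIV u"
  shows "gagliardo_pow r p (\<lambda>x. c * u x) = ennreal (\<bar>c\<bar> powr p) * gagliardo_pow r p u"
proof -
  have um: "u \<in> borel_measurable borel"
    using u by (rule borel_measurable_continuous_onI)
  note [measurable] = borel_measurable_gagliardo_integrand[OF um]
  show ?thesis
    using um by (simp add: gagliardo_pow_eq_nn_integral gagliardo_integrand_cmult ennreal_mult nn_integral_cmult)
qed

lemma gagliardo_pow_finite_iff:
  fixes u :: "'a::euclidean_space \<Rightarrow> real"
  assumes u: "continuous_on UNIV u"
  shows "gagliardo_pow r p u < \<infinity> \<longleftrightarrow> integrable lborel (gagliardo_integrand r p u)"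
proof -
  have um: "u \<in> borel_measurable borel"
    using u by (rule borel_measurable_continuous_onI)
  show ?thesis
    using borel_measurable_gagliardo_integrand[OF um, of r p]
    by (simp add: gagliardo_pow_eq_nn_integral[OF um] integrable_iff_bounded)
qed

lemma gagliardo_pow_eq_integral:
  fixes u :: "'a::euclidean_space \<Rightarrow> real"
  assumes u: "continuous_on UNIV u" and fin: "integrable lborel (gagliardo_integrand r p u)"
  shows "gagliardo_pow r p u = ennreal (\<integral>z. gagliardo_integrand r p u z \<partial>lborel)"
  using fin u by (simp add: gagliardo_pow_eq_nn_integral borel_measurable_continuous_onI nn_integral_eq_integral)

lemma gagliardo_pow_mono:
  assumes "0 \<le> p" "\<And>x y. \<bar>u x - u y\<bar> \<le> \<bar>v x - v y\<bar>"
  shows "gagliardo_pow r p u \<le> gagliardo_pow r p v"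
  unfolding gagliardo_pow_def
  using assms by (intro nn_integral_mono ennreal_leI divide_right_mono powr_mono2) auto

text \<open>Serves twice: for sums of two functions, and for the logarithmic test function, whose
  increments mix those of the minimiser and of the cutoff.\<close>

lemma gagliardo_pow_finite_of_lipschitz:
  fixes u v w :: "'a::euclidean_space \<Rightarrow> real"
  assumes p: "0 \<le> p" and cont: "continuous_on UNIV u" "continuous_on UNIV v" "continuous_on UNIV w"
    and fin: "gagliardo_pow r p u < \<infinity>" "gagliardo_pow r p v < \<infinity>"
    and C: "0 \<le> C" and w: "\<And>x y. \<bar>w x - w y\<bar> \<le> C * (\<bar>u x - u y\<bar> + \<bar>v x - v y\<bar>)"
  shows "gagliardo_pow r p w < \<infinity>"
proof -
  let ?B = "\<lambda>z. C powr p * 2 powr p * (gagliardo_integrand r p u z + gagliardo_integrand r p v z)"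
  have i: "integrable lborel ?B"
    using iffD1[OF gagliardo_pow_finite_iff fin(1)] iffD1[OF gagliardo_pow_finite_iff fin(2)] cont by simp
  have "integrable lborel (gagliardo_integrand r p w)"
  proof (rule Bochner_Integration.integrable_bound[OF i])
    show "gagliardo_integrand r p w \<in> borel_measurable lborel"
      using borel_measurable_gagliardo_integrand[of w r p] borel_measurable_continuous_onI[OF cont(3)] by simp
    have "gagliardo_integrand r p w z \<le> ?B z" for z
    proof -
      let ?a = "\<bar>u (fst z) - u (snd z)\<bar>" and ?b = "\<bar>v (fst z) - v (snd z)\<bar>"
      have "\<bar>w (fst z) - w (snd z)\<bar> powr p \<le> (C * (?a + ?b)) powr p"
        using p w by (intro powr_mono2) auto
      also have "\<dots> = C powr p * (?a + ?b) powr p"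
        using C by (simp add: powr_mult)
      also have "\<dots> \<le> C powr p * (2 powr p * (?a powr p + ?b powr p))"
        using p by (intro mult_left_mono sum_powr_bound) auto
      finally have "gagliardo_integrand r p w z \<le>
          C powr p * (2 powr p * (?a powr p + ?b powr p)) / norm (fst z - snd z) powr (real DIM('a) + r * p)"
        unfolding gagliardo_integrand_def by (intro divide_right_mono) auto
      then show ?thesis
        by (simp add: gagliardo_integrand_def add_divide_distrib distrib_left)
    qed
    moreover have "0 \<le> ?B z" for z
      by (intro mult_nonneg_nonneg add_nonneg_nonneg) auto
    ultimately show "AE z in lborel. norm (gagliardo_integrand r p w z) \<le> norm (?B z)"
      by (intro AE_I2) (metis abs_of_nonneg gagliardo_integrand_nonneg real_norm_def)
  qed
  then show ?thesis
    using gagliardo_pow_finite_iff[OF cont(3)] by blast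
qed

text \<open>The integrand of the weak form of the fractional \<open>p\<close>-Laplacian of
  \<open>u\<close> tested with \<open>\<phi>\<close>. Multiplied by \<open>p\<close> it is the
  derivative at \<open>h = 0\<close> of the Gagliardo integrand of
  \<open>u + h \<phi>\<close>.\<close>

definition gagliardo_form :: "real \<Rightarrow> real \<Rightarrow> ('a::euclidean_space \<Rightarrow> real) \<Rightarrow> ('a \<Rightarrow> real) \<Rightarrow> 'a \<times> 'a \<Rightarrow> real" where
  "gagliardo_form r p u \<phi> z =
     sgn (u (fst z) - u (snd z)) * \<bar>u (fst z) - u (snd z)\<bar> powr (p - 1) * (\<phi> (fst z) - \<phi> (snd z)) /
     norm (fst z - snd z) powr (real DIM('a) + r * p)"

text \<open>The difference quotients of the energy are nonnegative for \<open>h > 0\<close>,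
  converge pointwise to \<open>p\<close> times the form and are dominated by \<open>W\<close>. Only
  positive \<open>h\<close> is compared, so the conclusion is an inequality: \<open>u\<close> is a
  weak supersolution with respect to \<open>\<phi>\<close>.\<close>

lemma gagliardo_first_variation:
  fixes u \<phi> :: "'a::euclidean_space \<Rightarrow> real"
  assumes p: "1 < p" and cont: "continuous_on UNIV u" "continuous_on UNIV \<phi>"
    and fin: "gagliardo_pow r p u < \<infinity>" "gagliardo_pow r p \<phi> < \<infinity>"
    and min: "\<And>h. 0 < h \<Longrightarrow> gagliardo_pow r p u \<le> gagliardo_pow r p (\<lambda>x. u x + h * \<phi> x)"
  shows "integrable lborel (gagliardo_form r p u \<phi>)"
    and "0 \<le> (\<integral>z. gagliardo_form r p u \<phi> z \<partial>lborel)"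
proof -
  \<comment> \<open>The uniform bound on the quotients requires \<open>h n \<le> 1\<close>.\<close>
  define h where "h n = inverse (real (Suc n))" for n
  have h: "0 < h n" "h n \<le> 1" for n by (auto simp: h_def inverse_le_1_iff)
  have hlim: "h \<longlonglongrightarrow> 0" unfolding h_def by (rule LIMSEQ_inverse_real_of_nat)
  let ?u = "\<lambda>n x. u x + h n * \<phi> x"
  define s where "s n z = (gagliardo_integrand r p (?u n) z - gagliardo_integrand r p u z) / h n" for n z
  define W where "W z = p * 2 powr p * (gagliardo_integrand r p u z + gagliardo_integrand r p \<phi> z)" for z
  have cu: "continuous_on UNIV (?u n)" for n
    using cont by (intro continuous_intros)
  have um [measurable]: "u \<in> borel_measurable borel" "\<phi> \<in> borel_measurable borel"
    using cont borel_measurable_continuous_onI by auto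
  have gm [measurable]: "gagliardo_integrand r p u \<in> borel_measurable borel"
    "gagliardo_integrand r p \<phi> \<in> borel_measurable borel"
    "gagliardo_integrand r p (?u n) \<in> borel_measurable borel" for n
    using borel_measurable_gagliardo_integrand borel_measurable_continuous_onI cont cu by blast+
  have iu: "integrable lborel (gagliardo_integrand r p u)" "integrable lborel (gagliardo_integrand r p \<phi>)"
    using iffD1[OF gagliardo_pow_finite_iff fin(1)] iffD1[OF gagliardo_pow_finite_iff fin(2)] cont by auto
  have iW: "integrable lborel W"
    unfolding W_def[abs_def] using iu by simp
  let ?A = "\<lambda>z. u (fst z) - u (snd z)" and ?B = "\<lambda>z. \<phi> (fst z) - \<phi> (snd z)"
  let ?N = "\<lambda>z::'a \<times> 'a. norm (fst z - snd z) powr (real DIM('a) + r * p)"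
  have s_eq: "s n z = (\<bar>?A z + h n * ?B z\<bar> powr p - \<bar>?A z\<bar> powr p) / h n / ?N z" for n z
  proof -
    have eq: "u (fst z) + h n * \<phi> (fst z) - (u (snd z) + h n * \<phi> (snd z)) = ?A z + h n * ?B z"
      by (simp add: algebra_simps)
    show ?thesis
      unfolding s_def gagliardo_integrand_def eq by (simp add: diff_divide_distrib mult.commute)
  qed
  have bound: "\<bar>s n z\<bar> \<le> W z" for n z
  proof -
    have "\<bar>s n z\<bar> = \<bar>(\<bar>?A z + h n * ?B z\<bar> powr p - \<bar>?A z\<bar> powr p) / h n\<bar> / ?N z"
      unfolding s_eq abs_divide[of _ "?N z"] by simp
    also have "\<dots> \<le> p * 2 powr p * (\<bar>?A z\<bar> powr p + \<bar>?B z\<bar> powr p) / ?N z"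
      by (intro divide_right_mono abs_powr_quotient_bound p h) auto
    finally show ?thesis
      by (simp add: W_def gagliardo_integrand_def add_divide_distrib distrib_left)
  qed
  have lim: "(\<lambda>n. s n z) \<longlonglongrightarrow> p * gagliardo_form r p u \<phi> z" for z
  proof -
    have "((\<lambda>t. \<bar>?A z + t * ?B z\<bar> powr p) has_real_derivative
        p * (sgn (?A z + 0 * ?B z) * \<bar>?A z + 0 * ?B z\<bar> powr (p - 1)) * ?B z) (at 0)"
      by (rule DERIV_chain2[OF has_real_derivative_abs_powr[OF p], of _ "?B z"])
        (auto intro!: derivative_eq_intros)
    then have "((\<lambda>t. (\<bar>?A z + t * ?B z\<bar> powr p - \<bar>?A z\<bar> powr p) / t) \<longlongrightarrow>
        p * (sgn (?A z) * \<bar>?A z\<bar> powr (p - 1)) * ?B z) (at 0)"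
      by (simp add: has_field_derivative_iff)
    moreover have "filterlim h (at 0) sequentially"
      using hlim h by (simp add: filterlim_at less_imp_neq[symmetric] eventually_sequentially)
    ultimately have "(\<lambda>n. (\<bar>?A z + h n * ?B z\<bar> powr p - \<bar>?A z\<bar> powr p) / h n) \<longlonglongrightarrow>
        p * (sgn (?A z) * \<bar>?A z\<bar> powr (p - 1)) * ?B z"
      by (rule filterlim_compose)
    then have "(\<lambda>n. (\<bar>?A z + h n * ?B z\<bar> powr p - \<bar>?A z\<bar> powr p) / h n * (1 / ?N z)) \<longlonglongrightarrow>
        p * (sgn (?A z) * \<bar>?A z\<bar> powr (p - 1)) * ?B z * (1 / ?N z)"
      by (intro tendsto_mult tendsto_const)
    then show ?thesis
      by (simp add: s_eq gagliardo_form_def mult.assoc)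
  qed
  have sm: "s n \<in> borel_measurable lborel" for n
    unfolding s_def[abs_def] by measurable
  have fm: "(\<lambda>z. p * gagliardo_form r p u \<phi> z) \<in> borel_measurable lborel"
    using lim sm by (rule borel_measurable_LIMSEQ_real)
  have AEs: "AE z in lborel. (\<lambda>n. s n z) \<longlonglongrightarrow> p * gagliardo_form r p u \<phi> z"
    "AE z in lborel. norm (s n z) \<le> W z" for n
    using lim bound by auto
  have dc: "integrable lborel (\<lambda>z. p * gagliardo_form r p u \<phi> z)" "integrable lborel (s n)"
    "(\<lambda>n. integral\<^sup>L lborel (s n)) \<longlonglongrightarrow> (\<integral>z. p * gagliardo_form r p u \<phi> z \<partial>lborel)" for n
    by (rule integrable_dominated_convergence[OF fm sm iW AEs]
        integrable_dominated_convergence2[OF fm sm iW AEs]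
        integral_dominated_convergence[OF fm sm iW AEs])+
  have "0 \<le> integral\<^sup>L lborel (s n)" for n
  proof -
    have "gagliardo_integrand r p (?u n) = (\<lambda>z. gagliardo_integrand r p u z + h n * s n z)"
      using h[of n] by (auto simp: s_def)
    then have i: "integrable lborel (gagliardo_integrand r p (?u n))"
      using iu dc(2)[of n] by simp
    have "ennreal (\<integral>z. gagliardo_integrand r p u z \<partial>lborel) \<le> ennreal (\<integral>z. gagliardo_integrand r p (?u n) z \<partial>lborel)"
      using min[OF h(1)[of n]] by (simp add: gagliardo_pow_eq_integral cont cu iu i)
    then have "(\<integral>z. gagliardo_integrand r p u z \<partial>lborel) \<le> (\<integral>z. gagliardo_integrand r p (?u n) z \<partial>lborel)"
      by (subst (asm) ennreal_le_iff) auto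
    then show ?thesis
      unfolding s_def[abs_def] using iu i h[of n] by simp
  qed
  with dc(3) have "0 \<le> (\<integral>z. p * gagliardo_form r p u \<phi> z \<partial>lborel)"
    by (intro LIMSEQ_le_const) auto
  then show "0 \<le> (\<integral>z. gagliardo_form r p u \<phi> z \<partial>lborel)"
    using p by (simp add: zero_le_mult_iff)
  show "integrable lborel (gagliardo_form r p u \<phi>)"
    using dc(1) p by simp
qed

section \<open>The strong minimum principle\<close>

definition cutoff :: "'a::euclidean_space \<Rightarrow> real \<Rightarrow> 'a \<Rightarrow> real" where
  "cutoff z R x = max 0 (min 1 (2 - dist x z / R))"

lemma cutoff_bounds: "0 \<le> cutoff z R x" "cutoff z R x \<le> 1"
  by (auto simp: cutoff_def)

lemma cutoff_eq_1: "0 < R \<Longrightarrow> x \<in> cball z R \<Longrightarrow> cutoff z R x = 1"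
  by (simp add: cutoff_def dist_commute)

lemma cutoff_eq_0: "0 < R \<Longrightarrow> x \<notin> cball z (2 * R) \<Longrightarrow> cutoff z R x = 0"
  by (simp add: cutoff_def dist_commute field_simps)

lemma continuous_cutoff: "continuous_on UNIV (cutoff z R)"
  unfolding cutoff_def[abs_def] by (cases "R = 0") (auto intro!: continuous_intros)

lemma gagliardo_pow_cutoff_finite:
  fixes z :: "'a::euclidean_space"
  assumes "0 < r" "r < 1" "0 < p" "0 < R"
  shows "gagliardo_pow r p (cutoff z R) < \<infinity>"
proof (rule gagliardo_pow_lipschitz_finite[of r p _ "1 / R"])
  fix x y :: 'a
  have "\<bar>dist x z - dist y z\<bar> \<le> norm (x - y)"
    using dist_triangle[of x z y] dist_triangle[of y z x] by (simp add: dist_norm norm_minus_commute abs_le_iff)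
  then have "\<bar>dist x z / R - dist y z / R\<bar> \<le> norm (x - y) / R"
    using assms by (simp add: diff_divide_distrib[symmetric] abs_divide divide_right_mono)
  then show "\<bar>cutoff z R x - cutoff z R y\<bar> \<le> 1 / R * norm (x - y)"
    unfolding cutoff_def by simp
  show "\<bar>cutoff z R x - cutoff z R y\<bar> \<le> 1"
    using cutoff_bounds[of z R x] cutoff_bounds[of z R y] by linarith
  show "cutoff z R x = 0" if "x \<notin> cball z (2 * R)"
    using that assms by (intro cutoff_eq_0)
qed (use assms in auto)

lemma powr_neg_lipschitz:
  fixes a b \<delta> q :: real
  assumes "0 < \<delta>" "\<delta> \<le> a" "\<delta> \<le> b" "0 \<le> q"
  shows "\<bar>a powr (- q) - b powr (- q)\<bar> \<le> q * \<delta> powr (- q - 1) * \<bar>a - b\<bar>"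
proof -
  have "norm (a powr (- q) - b powr (- q)) \<le> q * \<delta> powr (- q - 1) * norm (a - b)"
  proof (rule field_differentiable_bound[where S = "{\<delta>..}"])
    fix x assume x: "x \<in> {\<delta>..}"
    then show "((\<lambda>x. x powr (- q)) has_field_derivative (- q * x powr (- q - 1))) (at x within {\<delta>..})"
      using assms by (auto intro!: derivative_eq_intros)
    have "x powr (- q - 1) \<le> \<delta> powr (- q - 1)"
      using x assms by (intro powr_mono2') auto
    then show "norm (- q * x powr (- q - 1)) \<le> q * \<delta> powr (- q - 1)"
      using assms by (simp add: abs_mult mult_left_mono)
  qed (use assms in auto)
  then show ?thesis by simp
qed

text \<open>The test function is a Lipschitz function of the pair (shifted minimiser, cutoff) as
  long as the first entry stays above \<delta>. It is thereby of finite energy; the dependence of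
  the constant on \<delta> does not enter any estimate of the logarithm.\<close>

lemma test_function_lipschitz:
  fixes a b s t \<delta> p :: real
  assumes p: "1 < p" and ab: "0 < \<delta>" "\<delta> \<le> a" "\<delta> \<le> b" and st: "0 \<le> s" "s \<le> 1" "0 \<le> t" "t \<le> 1"
  shows "\<bar>s powr p * a powr (1 - p) - t powr p * b powr (1 - p)\<bar> \<le>
    (p * 2 powr (p - 1) * \<delta> powr (1 - p) + (p - 1) * \<delta> powr (- p)) * (\<bar>a - b\<bar> + \<bar>s - t\<bar>)"
proof -
  let ?K = "p * 2 powr (p - 1)"
  have "\<bar>s powr p - t powr p\<bar> \<le> ?K * \<bar>s - t\<bar>"
  proof -
    have "\<bar>s powr p - t powr p\<bar> \<le> p * (\<bar>t\<bar> + \<bar>s - t\<bar>) powr (p - 1) * \<bar>s - t\<bar>"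
      using abs_powr_diff_bound[OF p, of t "s - t"] st by simp
    \<comment> \<open>As \<open>s\<close> and \<open>t\<close> lie between 0 and 1,
      \<open>\<bar>t\<bar> + \<bar>s - t\<bar> \<le> 2\<close>.\<close>
    also have "\<dots> \<le> ?K * \<bar>s - t\<bar>"
      using p st by (intro mult_right_mono mult_left_mono powr_mono2) auto
    finally show ?thesis .
  qed
  moreover have "a powr (1 - p) \<le> \<delta> powr (1 - p)"
    using p ab by (intro powr_mono2') auto
  ultimately have 1: "\<bar>s powr p - t powr p\<bar> * a powr (1 - p) \<le> ?K * \<bar>s - t\<bar> * \<delta> powr (1 - p)"
    by (intro mult_mono) (use p in auto)
  have "t powr p \<le> 1 powr p"
    using p st by (intro powr_mono2) auto
  moreover have "\<bar>a powr (1 - p) - b powr (1 - p)\<bar> \<le> (p - 1) * \<delta> powr (- p) * \<bar>a - b\<bar>"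
    using powr_neg_lipschitz[of \<delta> a b "p - 1"] p ab by simp
  ultimately have 2: "t powr p * \<bar>a powr (1 - p) - b powr (1 - p)\<bar> \<le> 1 * ((p - 1) * \<delta> powr (- p) * \<bar>a - b\<bar>)"
    by (intro mult_mono) auto
  have "s powr p * a powr (1 - p) - t powr p * b powr (1 - p) =
      (s powr p - t powr p) * a powr (1 - p) + t powr p * (a powr (1 - p) - b powr (1 - p))"
    by (simp add: algebra_simps)
  then have "\<bar>s powr p * a powr (1 - p) - t powr p * b powr (1 - p)\<bar> \<le>
      \<bar>s powr p - t powr p\<bar> * a powr (1 - p) + t powr p * \<bar>a powr (1 - p) - b powr (1 - p)\<bar>"
    using abs_triangle_ineq[of "(s powr p - t powr p) * a powr (1 - p)" "t powr p * (a powr (1 - p) - b powr (1 - p))"]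
    by (simp add: abs_mult)
  also have "\<dots> \<le> ?K * \<delta> powr (1 - p) * \<bar>s - t\<bar> + (p - 1) * \<delta> powr (- p) * \<bar>a - b\<bar>"
    using 1 2 by (simp add: mult_ac)
  also have "\<dots> \<le> (?K * \<delta> powr (1 - p) + (p - 1) * \<delta> powr (- p)) * (\<bar>a - b\<bar> + \<bar>s - t\<bar>)"
    using p by (simp add: distrib_left distrib_right)
  finally show ?thesis .
qed

text \<open>
  With \<open>\<psi>\<close> the cutoff and \<open>\<phi> = \<psi>\<^sup>p (u + \<delta>)\<^sup>1\<^sup>-\<^sup>p\<close> in the first variation, Picone's inequality bounds the
  form from above by the energy of \<open>\<psi>\<close>, and where \<open>\<psi> = 1\<close> its negative controls the energy of
  \<open>ln (u + \<delta>)\<close>.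
\<close>

lemma gagliardo_log_estimate:
  fixes u :: "'a::euclidean_space \<Rightarrow> real"
  assumes p: "1 < p" and r: "0 < r" "r < 1" and R: "0 < R" and \<delta>: "0 < \<delta>"
    and u: "continuous_on UNIV u" "\<And>x. 0 \<le> u x" "gagliardo_pow r p u < \<infinity>"
    and min: "\<And>\<phi>. continuous_on UNIV \<phi> \<Longrightarrow> (\<And>x. 0 \<le> \<phi> x) \<Longrightarrow> (\<And>x. x \<notin> cball z (2 * R) \<Longrightarrow> \<phi> x = 0) \<Longrightarrow>
        gagliardo_pow r p \<phi> < \<infinity> \<Longrightarrow> gagliardo_pow r p u \<le> gagliardo_pow r p (\<lambda>x. u x + \<phi> x)"
  shows "(\<integral>\<^sup>+w. indicator (cball z R \<times> cball z R) w *
      ennreal (gagliardo_integrand r p (\<lambda>x. ln (u x + \<delta>)) w) \<partial>lborel) \<le>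
    ennreal ((\<integral>w. gagliardo_integrand r p (cutoff z R) w \<partial>lborel) / ((p - 1) * (1/2) powr p))"
proof -
  define \<psi> where "\<psi> = cutoff z R"
  define c where "c = (p - 1) * (1/2) powr p"
  define D where "D = cball z R \<times> cball z R"
  have c: "0 < c" using p by (simp add: c_def)
  define \<phi> where "\<phi> x = \<psi> x powr p * (u x + \<delta>) powr (1 - p)" for x
  have ud: "0 < u x + \<delta>" for x using u(2)[of x] \<delta> by linarith
  have c\<psi>: "continuous_on UNIV \<psi>" unfolding \<psi>_def by (rule continuous_cutoff)
  have fin\<psi>: "gagliardo_pow r p \<psi> < \<infinity>"
    unfolding \<psi>_def using r p R by (intro gagliardo_pow_cutoff_finite) auto
  have i\<psi>: "integrable lborel (gagliardo_integrand r p \<psi>)"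
    using gagliardo_pow_finite_iff[OF c\<psi>] fin\<psi> by blast
  have \<psi>b: "0 \<le> \<psi> x" "\<psi> x \<le> 1" for x by (auto simp: \<psi>_def cutoff_bounds)
  have c\<phi>: "continuous_on UNIV \<phi>"
    unfolding \<phi>_def[abs_def]
    using c\<psi> u(1) p ud \<psi>b by (intro continuous_intros continuous_on_powr') (auto simp: less_imp_neq[OF ud, symmetric])
  have \<phi>0: "0 \<le> \<phi> x" for x by (simp add: \<phi>_def)
  have \<phi>s: "\<phi> x = 0" if "x \<notin> cball z (2 * R)" for x
    using cutoff_eq_0[OF R that] p by (simp add: \<phi>_def \<psi>_def)
  have fin\<phi>: "gagliardo_pow r p \<phi> < \<infinity>"
  proof (rule gagliardo_pow_finite_of_lipschitz[OF _ u(1) c\<psi> c\<phi> u(3) fin\<psi>])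
    fix x y
    show "\<bar>\<phi> x - \<phi> y\<bar> \<le> (p * 2 powr (p - 1) * \<delta> powr (1 - p) + (p - 1) * \<delta> powr (- p)) * (\<bar>u x - u y\<bar> + \<bar>\<psi> x - \<psi> y\<bar>)"
      using test_function_lipschitz[OF p \<delta>, of "u x + \<delta>" "u y + \<delta>" "\<psi> x" "\<psi> y"] u(2) \<psi>b
      by (simp add: \<phi>_def)
  qed (use p in auto)
  have "gagliardo_pow r p u \<le> gagliardo_pow r p (\<lambda>x. u x + h * \<phi> x)" if h: "0 < h" for h
  proof (rule min)
    show "continuous_on UNIV (\<lambda>x. h * \<phi> x)" using c\<phi> by (intro continuous_intros)
    show "gagliardo_pow r p (\<lambda>x. h * \<phi> x) < \<infinity>"
      using fin\<phi> by (simp add: gagliardo_pow_cmult[OF c\<phi>] ennreal_mult_less_top)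
  qed (use h \<phi>0 \<phi>s in auto)
  note fv = gagliardo_first_variation[OF p u(1) c\<phi> u(3) fin\<phi> this]
  \<comment> \<open>On \<open>D\<close> both cutoff values are 1 and the logarithmic inequality
    applies. Off \<open>D\<close> the left side is zero, and Picone's inequality says that the right
    side is nonnegative.\<close>
  have pt: "c * (indicator D w * gagliardo_integrand r p (\<lambda>x. ln (u x + \<delta>)) w) \<le>
      gagliardo_integrand r p \<psi> w - gagliardo_form r p u \<phi> w" for w
  proof -
    let ?a = "u (fst w) + \<delta>" and ?b = "u (snd w) + \<delta>"
    let ?s = "\<psi> (fst w)" and ?t = "\<psi> (snd w)"
    let ?N = "norm (fst w - snd w) powr (real DIM('a) + r * p)"
    let ?J = "sgn (?a - ?b) * \<bar>?a - ?b\<bar> powr (p - 1) * (?s powr p * ?a powr (1 - p) - ?t powr p * ?b powr (1 - p))"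
    have form: "gagliardo_form r p u \<phi> w = ?J / ?N"
      by (simp add: gagliardo_form_def \<phi>_def)
    have "c * (indicator D w * \<bar>ln ?a - ln ?b\<bar> powr p) \<le> \<bar>?s - ?t\<bar> powr p - ?J"
    proof (cases "w \<in> D")
      case True
      then have "?s = 1" "?t = 1"
        using R by (auto simp: \<psi>_def D_def cutoff_eq_1 mem_Times_iff)
      then show ?thesis
        using discrete_log_inequality[OF p ud ud, of "fst w" "snd w"] True p by (simp add: c_def)
    next
      case False
      then show ?thesis
        using discrete_picone[OF p ud ud \<psi>b(1) \<psi>b(1), of "fst w" "snd w" "fst w" "snd w"] by simp
    qed
    then have "c * (indicator D w * \<bar>ln ?a - ln ?b\<bar> powr p) / ?N \<le> (\<bar>?s - ?t\<bar> powr p - ?J) / ?N"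
      by (rule divide_right_mono) simp
    then show ?thesis
      unfolding form by (simp add: gagliardo_integrand_def diff_divide_distrib)
  qed
  define I where "I = (\<integral>w. gagliardo_integrand r p \<psi> w - gagliardo_form r p u \<phi> w \<partial>lborel)"
  have "(\<integral>\<^sup>+w. indicator D w * ennreal (gagliardo_integrand r p (\<lambda>x. ln (u x + \<delta>)) w) \<partial>lborel) \<le>
      (\<integral>\<^sup>+w. ennreal ((gagliardo_integrand r p \<psi> w - gagliardo_form r p u \<phi> w) / c) \<partial>lborel)"
  proof (rule nn_integral_mono)
    fix w
    have "indicator D w * ennreal (gagliardo_integrand r p (\<lambda>x. ln (u x + \<delta>)) w) =
        ennreal (indicator D w * gagliardo_integrand r p (\<lambda>x. ln (u x + \<delta>)) w)"
      by (simp add: indicator_def)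
    also have "\<dots> \<le> ennreal ((gagliardo_integrand r p \<psi> w - gagliardo_form r p u \<phi> w) / c)"
      using pt[of w] c by (intro ennreal_leI) (simp add: field_simps)
    finally show "indicator D w * ennreal (gagliardo_integrand r p (\<lambda>x. ln (u x + \<delta>)) w) \<le>
        ennreal ((gagliardo_integrand r p \<psi> w - gagliardo_form r p u \<phi> w) / c)" .
  qed
  also have "\<dots> = ennreal (I / c)"
  proof -
    have "0 \<le> (gagliardo_integrand r p \<psi> w - gagliardo_form r p u \<phi> w) / c" for w
    proof -
      have "0 \<le> c * (indicator D w * gagliardo_integrand r p (\<lambda>x. ln (u x + \<delta>)) w)"
        using c by simp
      then show ?thesis using pt[of w] c by (intro divide_nonneg_pos) linarith+
    qed
    then show ?thesis
      using i\<psi> fv(1) unfolding I_def by (subst nn_integral_eq_integral) auto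
  qed
  \<comment> \<open>The integral of the form is nonnegative by the first variation and is dropped;
    the dependence on \<delta> goes with it.\<close>
  also have "\<dots> \<le> ennreal ((\<integral>w. gagliardo_integrand r p \<psi> w \<partial>lborel) / c)"
    using i\<psi> fv c unfolding I_def by (intro ennreal_leI divide_right_mono) auto
  finally show ?thesis
    by (simp add: D_def \<psi>_def c_def)
qed

text \<open>At the zero \<open>z\<close> the logarithm equals \<open>ln \<delta>\<close>, so the
  oscillation bound reads \<open>u x \<le> \<delta> * exp K\<close> with \<open>K\<close>
  independent of \<delta>. The radius \<open>R / 2\<close> keeps the ball about \<open>x\<close> of
  radius \<open>dist x z\<close> inside \<open>cball z R\<close>, where the energy is
  controlled.\<close>

lemma minimizer_vanishes_near_zero:
  fixes u :: "'a::euclidean_space \<Rightarrow> real"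
  assumes p: "1 < p" and r: "0 < r" "r < 1" "real DIM('a) < r * p" and R: "0 < R"
    and u: "continuous_on UNIV u" "\<And>x. 0 \<le> u x" "gagliardo_pow r p u < \<infinity>"
    and min: "\<And>\<phi>. continuous_on UNIV \<phi> \<Longrightarrow> (\<And>x. 0 \<le> \<phi> x) \<Longrightarrow> (\<And>x. x \<notin> cball z (2 * R) \<Longrightarrow> \<phi> x = 0) \<Longrightarrow>
        gagliardo_pow r p \<phi> < \<infinity> \<Longrightarrow> gagliardo_pow r p u \<le> gagliardo_pow r p (\<lambda>x. u x + \<phi> x)"
    and z: "u z = 0" and x: "x \<in> cball z (R / 2)"
  shows "u x = 0"
proof -
  \<comment> \<open>The summand 1 makes \<open>M\<close> strictly positive, as the Morrey inequality
    demands.\<close>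
  define M where "M = (\<integral>w. gagliardo_integrand r p (cutoff z R) w \<partial>lborel) / ((p - 1) * (1/2) powr p) + 1"
  have M: "0 < M"
    unfolding M_def using p by (intro add_nonneg_pos divide_nonneg_nonneg integral_nonneg) auto
  define K where "K = morrey_const TYPE('a) r p * M powr (1 / p) * dist x z powr (r - real DIM('a) / p)"
  have bound: "u x \<le> \<delta> * exp K" if \<delta>: "0 < \<delta>" for \<delta>
  proof -
    have ud: "0 < u y + \<delta>" for y using u(2)[of y] \<delta> by linarith
    let ?w = "\<lambda>y. ln (u y + \<delta>)"
    have "\<bar>?w x - ?w z\<bar> \<le> K"
      unfolding K_def
    proof (rule fractional_morrey[where D = "cball z R"])
      show "continuous_on UNIV ?w"
        using u(1) by (intro continuous_intros) (auto simp: less_imp_neq[OF ud, symmetric])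
      show "cball x (dist x z) \<subseteq> cball z R"
      proof
        fix y assume "y \<in> cball x (dist x z)"
        then show "y \<in> cball z R"
          using x dist_triangle[of z y x] by (simp add: dist_commute)
      qed
      show "cball z (dist x z) \<subseteq> cball z R"
        using x R by (intro subset_cball) (simp add: dist_commute)
      show "(\<integral>\<^sup>+w. indicator (cball z R \<times> cball z R) w * ennreal (gagliardo_integrand r p ?w w) \<partial>lborel) \<le> ennreal M"
        by (rule order_trans[OF gagliardo_log_estimate[OF p r(1,2) R \<delta> u min]])
          (auto simp: M_def intro!: ennreal_leI)
    qed (use p r M in auto)
    then have "ln (u x + \<delta>) \<le> ln \<delta> + K"
      using z by simp
    then have "u x + \<delta> \<le> exp (ln \<delta> + K)"
      using ud[of x] ln_le_cancel_iff by (metis exp_le_cancel_iff exp_ln)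
    then show ?thesis using \<delta> by (simp add: exp_add)
  qed
  have "u x \<le> 0 + e" if "0 < e" for e
    using bound[of "e / exp K"] that by simp
  then have "u x \<le> 0" by (rule field_le_epsilon)
  then show ?thesis using u(2)[of x] by simp
qed

lemma strong_minimum_principle:
  fixes u :: "'a::euclidean_space \<Rightarrow> real"
  assumes p: "1 < p" and r: "0 < r" "r < 1" "real DIM('a) < r * p"
    and \<Omega>: "open \<Omega>" "connected \<Omega>"
    and u: "continuous_on UNIV u" "\<And>x. 0 \<le> u x" "gagliardo_pow r p u < \<infinity>"
    and min: "\<And>\<phi>. continuous_on UNIV \<phi> \<Longrightarrow> (\<And>x. 0 \<le> \<phi> x) \<Longrightarrow> (\<And>x. x \<notin> \<Omega> \<Longrightarrow> \<phi> x = 0) \<Longrightarrow>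
        gagliardo_pow r p \<phi> < \<infinity> \<Longrightarrow> gagliardo_pow r p u \<le> gagliardo_pow r p (\<lambda>x. u x + \<phi> x)"
    and nontriv: "y \<in> \<Omega>" "u y \<noteq> 0" and x: "x \<in> \<Omega>"
  shows "0 < u x"
proof (rule ccontr)
  assume "\<not> 0 < u x"
  then have ux: "u x = 0" using u(2)[of x] by simp
  let ?P = "{x \<in> \<Omega>. u x \<noteq> 0}" and ?Z = "{x \<in> \<Omega>. u x = 0}"
  have "open (u -` (- {0}))"
    using u(1) by (intro open_vimage) auto
  then have oP: "open (\<Omega> \<inter> u -` (- {0}))"
    using \<Omega> by (intro open_Int)
  have oZ: "open ?Z"
    unfolding open_contains_cball
  proof
    fix z assume "z \<in> ?Z"
    then have z: "z \<in> \<Omega>" "u z = 0" by auto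
    then obtain e where e: "0 < e" "cball z e \<subseteq> \<Omega>"
      using \<Omega>(1) open_contains_cball by blast
    \<comment> \<open>The perturbations are supported in \<open>cball z (2 * R)\<close>, which has
      to stay inside \<open>\<Omega>\<close>.\<close>
    define R where "R = e / 2"
    have R: "0 < R" "cball z (2 * R) \<subseteq> \<Omega>" using e by (auto simp: R_def)
    have "u w = 0" if "w \<in> cball z (R / 2)" for w
    proof (rule minimizer_vanishes_near_zero[OF p r R(1) u _ z(2) that])
      fix \<phi> :: "'a \<Rightarrow> real"
      assume "continuous_on UNIV \<phi>" "\<And>x. 0 \<le> \<phi> x" "\<And>x. x \<notin> cball z (2 * R) \<Longrightarrow> \<phi> x = 0" "gagliardo_pow r p \<phi> < \<infinity>"
      then show "gagliardo_pow r p u \<le> gagliardo_pow r p (\<lambda>x. u x + \<phi> x)"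
        using R(2) by (intro min) blast+
    qed
    moreover have "cball z (R / 2) \<subseteq> \<Omega>"
      using R by (intro order_trans[OF subset_cball R(2)]) simp
    ultimately show "\<exists>e>0. cball z e \<subseteq> ?Z"
      using R by (intro exI[of _ "R / 2"]) auto
  qed
  have "\<Omega> \<inter> u -` (- {0}) = ?P" by auto
  with oP have "open ?P" by simp
  with \<Omega>(2) oZ show False
    unfolding connected_def using ux x nontriv by blast
qed

section \<open>Compactness\<close>

text \<open>Otherwise continuity would give a nonempty open set outside the closure on which
  \<open>v\<close> is nonzero, contradicting that this happens only on a null set.\<close>

lemma W0_vanishes_outside_closure:
  fixes v :: "'a::euclidean_space \<Rightarrow> real"
  assumes v: "continuous_on UNIV v" "AE x in lebesgue. x \<notin> \<Omega> \<longrightarrow> v x = 0" and x: "x \<notin> closure \<Omega>"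
  shows "v x = 0"
proof (rule ccontr)
  assume "v x \<noteq> 0"
  let ?U = "(- closure \<Omega>) \<inter> v -` (- {0})"
  have "open ?U"
    using v(1) by (intro open_Int open_vimage) auto
  moreover have "x \<in> ?U" using x \<open>v x \<noteq> 0\<close> by simp
  ultimately have "\<not> negligible ?U"
    using open_not_negligible by blast
  moreover have "negligible ?U"
  proof -
    obtain N where N: "N \<in> null_sets lebesgue" "{x \<in> space lebesgue. \<not> (x \<notin> \<Omega> \<longrightarrow> v x = 0)} \<subseteq> N"
      using v(2) unfolding eventually_ae_filter by blast
    moreover have "?U \<subseteq> {x \<in> space lebesgue. \<not> (x \<notin> \<Omega> \<longrightarrow> v x = 0)}"
      using closure_subset by auto
    ultimately show ?thesis
      by (meson negligible_iff_null_sets negligible_subset order_trans)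
  qed
  ultimately show False by blast
qed

lemma integrable_continuous_compact_support:
  fixes f :: "'a::euclidean_space \<Rightarrow> real"
  assumes f: "continuous_on UNIV f" and B: "bounded B" "\<And>x. x \<notin> closure B \<Longrightarrow> f x = 0"
  shows "integrable lebesgue f"
proof -
  have "integrable lborel (\<lambda>x. indicator (closure B) x *\<^sub>R f x)"
    using B(1) by (intro borel_integrable_compact continuous_on_subset[OF f]) auto
  moreover have "(\<lambda>x. indicator (closure B) x *\<^sub>R f x) = f"
    using B(2) by (auto simp: indicator_def fun_eq_iff)
  ultimately have "integrable lborel f" by simp
  then show ?thesis
    by (simp add: integrable_completion borel_measurable_integrable)
qed

lemma W0_continuousI:
  fixes v :: "'a::euclidean_space \<Rightarrow> real"
  assumes p: "0 < p" and \<Omega>: "bounded \<Omega>" and v: "continuous_on UNIV v"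
    and vanish: "AE x in lebesgue. x \<notin> \<Omega> \<longrightarrow> v x = 0" and fin: "gagliardo_pow r p v < \<infinity>"
  shows "v \<in> W0 r p \<Omega>"
proof -
  have "v \<in> borel_measurable lebesgue"
    using borel_measurable_continuous_onI[OF v] by (simp add: measurable_completion)
  moreover have "integrable lebesgue (\<lambda>x. \<bar>v x\<bar> powr p)"
    using v p W0_vanishes_outside_closure[OF v vanish]
    by (intro integrable_continuous_compact_support[OF _ \<Omega>] continuous_on_powr' continuous_intros) auto
  ultimately show ?thesis
    using vanish fin by (simp add: W0_def)
qed

lemma set_integrable_abs_powr:
  fixes u :: "'a::euclidean_space \<Rightarrow> real"
  assumes \<Omega>: "open \<Omega>" "bounded \<Omega>" and u: "continuous_on UNIV u" and a: "0 < a"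
  shows "set_integrable lebesgue \<Omega> (\<lambda>x. \<bar>u x\<bar> powr a)"
proof -
  have "set_integrable lborel (closure \<Omega>) (\<lambda>x. \<bar>u x\<bar> powr a)"
    unfolding set_integrable_def using \<Omega> a
    by (intro borel_integrable_compact continuous_on_powr' continuous_intros continuous_on_subset[OF u]) auto
  then have "set_integrable lborel \<Omega> (\<lambda>x. \<bar>u x\<bar> powr a)"
    by (rule set_integrable_subset) (use \<Omega> closure_subset in auto)
  then show ?thesis
    unfolding set_integrable_def by (simp add: integrable_completion borel_measurable_integrable)
qed

lemma W0_hoelder:
  fixes v :: "'a::euclidean_space \<Rightarrow> real"
  assumes v: "continuous_on UNIV v" and p: "1 \<le> p" and r: "0 < r" "real DIM('a) < r * p"
    and M: "0 < M" "gagliardo_pow r p v \<le> ennreal M"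
  shows "\<bar>v x - v y\<bar> \<le> morrey_const TYPE('a) r p * M powr (1 / p) * dist x y powr (r - real DIM('a) / p)"
proof (rule fractional_morrey[OF v p r M(1), of x y UNIV])
  show "(\<integral>\<^sup>+z. indicator (UNIV \<times> UNIV) z * ennreal (gagliardo_integrand r p v z) \<partial>lborel) \<le> ennreal M"
    using M(2) by (simp add: gagliardo_pow_eq_nn_integral borel_measurable_continuous_onI[OF v])
qed auto

lemma hoelder_continuous_on:
  fixes u :: "'a::metric_space \<Rightarrow> real"
  assumes "\<And>x y. \<bar>u x - u y\<bar> \<le> H * dist x y powr \<sigma>" and "0 < \<sigma>"
  shows "continuous_on UNIV u"
  unfolding continuous_on_eq_continuous_at[OF open_UNIV] isCont_def
proof (intro ballI)
  fix x :: 'a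
  have "((\<lambda>y. H * dist y x powr \<sigma>) \<longlongrightarrow> H * dist x x powr \<sigma>) (at x)"
    using assms(2) by (intro tendsto_intros tendsto_powr') auto
  then have lim: "((\<lambda>y. H * dist y x powr \<sigma>) \<longlongrightarrow> 0) (at x)"
    by simp
  have "\<forall>\<^sub>F y in at x. norm (u y - u x) \<le> H * dist y x powr \<sigma>"
    using assms(1) by (intro always_eventually allI) (simp only: real_norm_def)
  then have "((\<lambda>y. u y - u x) \<longlongrightarrow> 0) (at x)"
    using lim by (rule Lim_null_comparison)
  then show "(u \<longlongrightarrow> u x) (at x)"
    by (simp add: LIM_zero_iff)
qed

lemma morrey_const_pos:
  assumes "1 \<le> p" "real DIM('a::euclidean_space) < r * p"
  shows "0 < morrey_const TYPE('a) r p"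
proof -
  have "0 < r - real DIM('a) / p" using assms by (simp add: field_simps)
  then have "(1/2::real) powr (r - real DIM('a) / p) < 1"
    using powr_less_mono'[of "1/2" 0 "r - real DIM('a) / p"] by simp
  then show ?thesis
    unfolding morrey_const_def by (intro mult_pos_pos add_pos_pos add_pos_nonneg) auto
qed

text \<open>Fatou's lemma applied to the sum of the two integrands. Along a minimising sequence only
  the total energy is known to approach its limit, not the share of each component.\<close>

lemma gagliardo_sum_lower_semicontinuous:
  fixes u v :: "'a::euclidean_space \<Rightarrow> real"
  assumes p: "0 < p"
    and cont: "\<And>n. continuous_on UNIV (U n)" "\<And>n. continuous_on UNIV (V n)" "continuous_on UNIV u" "continuous_on UNIV v"
    and lim: "\<And>x. (\<lambda>n. U n x) \<longlonglongrightarrow> u x" "\<And>x. (\<lambda>n. V n x) \<longlonglongrightarrow> v x"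
    and bound: "\<And>n. gagliardo_pow s p (U n) + gagliardo_pow t p (V n) \<le> ennreal (e n)"
    and e: "e \<longlonglongrightarrow> L"
  shows "gagliardo_pow s p u + gagliardo_pow t p v \<le> ennreal L"
proof -
  note meas = borel_measurable_gagliardo_integrand[OF borel_measurable_continuous_onI]
  note [measurable] = meas[OF cont(1)] meas[OF cont(2)] meas[OF cont(3)] meas[OF cont(4)]
  let ?F = "\<lambda>u v z. ennreal (gagliardo_integrand s p u z) + ennreal (gagliardo_integrand t p v z)"
  have eq: "gagliardo_pow s p f + gagliardo_pow t p g = (\<integral>\<^sup>+z. ?F f g z \<partial>lborel)"
    if "continuous_on UNIV f" "continuous_on UNIV g" for f g :: "'a \<Rightarrow> real"
    using meas[OF that(1)] meas[OF that(2)] that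
    by (simp add: gagliardo_pow_eq_nn_integral borel_measurable_continuous_onI nn_integral_add)
  have gl: "(\<lambda>n. ennreal (gagliardo_integrand r p (f n) z)) \<longlonglongrightarrow> ennreal (gagliardo_integrand r p g z)"
    if "\<And>x. (\<lambda>n. f n x) \<longlonglongrightarrow> g x" for r z and f :: "nat \<Rightarrow> 'a \<Rightarrow> real" and g
    unfolding gagliardo_integrand_def divide_inverse using p
    by (intro tendsto_ennrealI tendsto_mult tendsto_const tendsto_powr' tendsto_rabs tendsto_diff that) auto
  have lF: "liminf (\<lambda>n. ?F (U n) (V n) z) = ?F u v z" for z
    by (intro lim_imp_Liminf tendsto_add gl lim) simp
  have "gagliardo_pow s p u + gagliardo_pow t p v = (\<integral>\<^sup>+z. liminf (\<lambda>n. ?F (U n) (V n) z) \<partial>lborel)"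
    by (simp add: eq cont lF)
  also have "\<dots> \<le> liminf (\<lambda>n. \<integral>\<^sup>+z. ?F (U n) (V n) z \<partial>lborel)"
    by (intro nn_integral_liminf) simp
  also have "\<dots> \<le> liminf (\<lambda>n. ennreal (e n))"
    using bound by (intro Liminf_mono) (simp add: eq cont)
  also have "\<dots> = ennreal L"
    using e by (intro lim_imp_Liminf tendsto_ennrealI) auto
  finally show ?thesis .
qed

text \<open>The common energy bound gives Hoelder bounds with constants independent of
  \<open>n\<close>, hence equicontinuity. The uniform bound \<open>B\<close> on the first component
  is exported for dominated convergence of its integral.\<close>

lemma gagliardo_compactness:
  fixes U V :: "nat \<Rightarrow> 'a::euclidean_space \<Rightarrow> real"
  assumes \<Omega>: "bounded \<Omega>" and p: "1 \<le> p"
    and r: "0 < s" "real DIM('a) < s * p" "0 < t" "real DIM('a) < t * p"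
    and cont: "\<And>n. continuous_on UNIV (U n)" "\<And>n. continuous_on UNIV (V n)"
    and vanish: "\<And>n x. x \<notin> closure \<Omega> \<Longrightarrow> U n x = 0" "\<And>n x. x \<notin> closure \<Omega> \<Longrightarrow> V n x = 0"
    and K: "0 < K" "\<And>n. gagliardo_pow s p (U n) \<le> ennreal K" "\<And>n. gagliardo_pow t p (V n) \<le> ennreal K"
  obtains k u v B where "strict_mono (k :: nat \<Rightarrow> nat)" "continuous_on UNIV u" "continuous_on UNIV v"
    "\<And>x. (\<lambda>n. U (k n) x) \<longlonglongrightarrow> u x" "\<And>x. (\<lambda>n. V (k n) x) \<longlonglongrightarrow> v x"
    "\<And>n x. \<bar>U n x\<bar> \<le> B"
proof -
  define \<sigma> where "\<sigma> r = r - real DIM('a) / p" for r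
  define H where "H r = morrey_const TYPE('a) r p * K powr (1 / p)" for r
  have \<sigma>: "0 < \<sigma> s" "0 < \<sigma> t" using r p by (simp_all add: \<sigma>_def field_simps)
  have H: "0 \<le> H s" "0 \<le> H t"
    using morrey_const_pos[OF p r(2)] morrey_const_pos[OF p r(4)] by (auto simp: H_def)
  have hoelder: "\<bar>U n x - U n y\<bar> \<le> H s * dist x y powr \<sigma> s" "\<bar>V n x - V n y\<bar> \<le> H t * dist x y powr \<sigma> t" for n x y
    unfolding H_def \<sigma>_def using K r by (auto intro!: W0_hoelder cont p)
  have "bounded (closure \<Omega>)" using \<Omega> by (rule bounded_closure)
  then obtain R where R: "0 < R" "closure \<Omega> \<subseteq> cball 0 R"
    by (meson bounded_subset_ballD ball_subset_cball order_trans)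
  define S where "S = (cball 0 R :: 'a set)"
  \<comment> \<open>All functions vanish at \<open>y0\<close>, so the Hoelder bound relative to this
    point becomes a uniform bound.\<close>
  obtain y0 :: 'a where y0: "y0 \<notin> closure \<Omega>"
    using \<Omega> bounded_closure not_bounded_UNIV by (metis UNIV_eq_I)
  have bound: "\<bar>f x\<bar> \<le> h * (R + norm y0) powr \<tau>"
    if "\<And>x y. \<bar>f x - f y\<bar> \<le> h * dist x y powr \<tau>" "\<And>x. x \<notin> closure \<Omega> \<Longrightarrow> f x = 0" "0 < \<tau>" "0 \<le> h"
    for f h \<tau> and x :: 'a
  proof (cases "x \<in> closure \<Omega>")
    case True
    then have "norm x \<le> R" using R by auto
    then have "dist x y0 \<le> R + norm y0"
      using norm_triangle_ineq4[of x y0] by (simp add: dist_norm)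
    then have "h * dist x y0 powr \<tau> \<le> h * (R + norm y0) powr \<tau>"
      using that by (intro mult_left_mono powr_mono2) auto
    then show ?thesis using that(1)[of x y0] that(2)[OF y0] by simp
  qed (use that R in simp)
  define BU where "BU = H s * (R + norm y0) powr \<sigma> s"
  define BV where "BV = H t * (R + norm y0) powr \<sigma> t"
  have bU: "\<bar>U n x\<bar> \<le> BU" and bV: "\<bar>V n x\<bar> \<le> BV" for n x
    unfolding BU_def BV_def
    by (rule bound[OF hoelder(1) vanish(1) \<sigma>(1) H(1)] bound[OF hoelder(2) vanish(2) \<sigma>(2) H(2)]; simp)+
  have pair: "norm (a, b) \<le> \<bar>a\<bar> + \<bar>b\<bar>" for a b :: real
    using norm_Pair_le[of a b] by simp
  have equi: "\<exists>d. 0 < d \<and> (\<forall>n y. y \<in> S \<and> norm (x - y) < d \<longrightarrow> norm ((U n x, V n x) - (U n y, V n y)) < e)"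
    if e: "0 < e" for x e
  proof -
    have "((\<lambda>y. H s * dist y x powr \<sigma> s + H t * dist y x powr \<sigma> t) \<longlongrightarrow>
        H s * dist x x powr \<sigma> s + H t * dist x x powr \<sigma> t) (at x)"
      using \<sigma> by (intro tendsto_intros tendsto_powr') auto
    then have "\<forall>\<^sub>F y in at x. H s * dist y x powr \<sigma> s + H t * dist y x powr \<sigma> t < e"
      using e by (intro order_tendstoD(2)) auto
    then obtain d where d: "0 < d" "\<And>y. y \<noteq> x \<Longrightarrow> dist y x < d \<Longrightarrow> H s * dist y x powr \<sigma> s + H t * dist y x powr \<sigma> t < e"
      unfolding eventually_at by auto
    show ?thesis
    proof (intro exI[of _ d] conjI allI impI)
      fix n y assume y: "y \<in> S \<and> norm (x - y) < d"
      show "norm ((U n x, V n x) - (U n y, V n y)) < e"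
      proof (cases "y = x")
        case False
        have "norm ((U n x, V n x) - (U n y, V n y)) \<le> \<bar>U n x - U n y\<bar> + \<bar>V n x - V n y\<bar>"
          using pair by simp
        also have "\<dots> \<le> H s * dist y x powr \<sigma> s + H t * dist y x powr \<sigma> t"
          using hoelder[of n x y] by (simp add: dist_commute)
        also have "\<dots> < e"
          using d(2)[OF False] y by (simp add: dist_norm norm_minus_commute)
        finally show ?thesis .
      qed (use e in \<open>simp add: zero_prod_def[symmetric]\<close>)
    qed (fact d)
  qed
  obtain g and k :: "nat \<Rightarrow> nat" where k: "strict_mono k"
    and g: "\<And>e. 0 < e \<Longrightarrow> \<exists>N. \<forall>n x. N \<le> n \<and> x \<in> S \<longrightarrow> norm ((U (k n) x, V (k n) x) - g x) < e"
  \<comment> \<open>Applied to pairs of values, so that one subsequence serves both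
    components.\<close>
  proof (rule Arzela_Ascoli[of S "\<lambda>n x. (U n x, V n x)" "BU + BV"])
    show "compact S" by (simp add: S_def)
    show "norm (U n x, V n x) \<le> BU + BV" if "x \<in> S" for n x
      using pair[of "U n x" "V n x"] bU[of n x] bV[of n x] by linarith
  qed (use equi in auto)
  have lim: "(\<lambda>n. (U (k n) x, V (k n) x)) \<longlonglongrightarrow> (if x \<in> S then g x else 0)" for x
  proof (cases "x \<in> S")
    case True
    show ?thesis
      unfolding LIMSEQ_iff
    proof (intro allI impI)
      fix e :: real assume "0 < e"
      then obtain N where "\<forall>n y. N \<le> n \<and> y \<in> S \<longrightarrow> norm ((U (k n) y, V (k n) y) - g y) < e"
        using g by blast
      then show "\<exists>N. \<forall>n\<ge>N. norm ((U (k n) x, V (k n) x) - (if x \<in> S then g x else 0)) < e"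
        using True by (intro exI[of _ N]) auto
    qed
  next
    case False
    then have "x \<notin> closure \<Omega>" using R by (auto simp: S_def)
    then show ?thesis using False by (simp add: vanish zero_prod_def)
  qed
  define u where "u x = fst (if x \<in> S then g x else 0)" for x
  define v where "v x = snd (if x \<in> S then g x else 0)" for x
  have lu: "(\<lambda>n. U (k n) x) \<longlonglongrightarrow> u x" and lv: "(\<lambda>n. V (k n) x) \<longlonglongrightarrow> v x" for x
    using tendsto_fst[OF lim[of x]] tendsto_snd[OF lim[of x]] by (simp_all add: u_def v_def)
  have "\<bar>u x - u y\<bar> \<le> H s * dist x y powr \<sigma> s" for x y
    using hoelder(1) by (intro LIMSEQ_le_const2[OF tendsto_rabs[OF tendsto_diff[OF lu lu]]]) auto
  then have cu: "continuous_on UNIV u"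
    using \<sigma>(1) by (rule hoelder_continuous_on)
  have "\<bar>v x - v y\<bar> \<le> H t * dist x y powr \<sigma> t" for x y
    using hoelder(2) by (intro LIMSEQ_le_const2[OF tendsto_rabs[OF tendsto_diff[OF lv lv]]]) auto
  then have cv: "continuous_on UNIV v"
    using \<sigma>(2) by (rule hoelder_continuous_on)
  show thesis
    by (rule that[OF k cu cv lu lv bU])
qed

section \<open>The minimisation problem\<close>

text \<open>One exponent \<open>p\<close> is fixed. The conditions on \<open>s\<close> and
  \<open>t\<close> have the same form, so the Morrey inequality and the minimum principle apply to
  either component.\<close>

locale gagliardo_system =
  fixes \<Omega> :: "'a::euclidean_space set" and x0 :: 'a and s t p :: real and \<alpha> \<beta> :: "real \<Rightarrow> real"
  assumes open_\<Omega>: "open \<Omega>" and connected_\<Omega>: "connected \<Omega>" and bounded_\<Omega>: "bounded \<Omega>" and x0: "x0 \<in> \<Omega>"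
    and s: "0 < s" "s < 1" "real DIM('a) < s * p" and t: "0 < t" "t < 1" "real DIM('a) < t * p"
    and p: "1 < p" and \<alpha>: "0 < \<alpha> p" and \<beta>: "0 < \<beta> p" and \<alpha>\<beta>: "\<alpha> p + \<beta> p = p"
begin

definition mass :: "('a \<Rightarrow> real) \<Rightarrow> real" where
  "mass u = (LINT x:\<Omega>|lebesgue. \<bar>u x\<bar> powr \<alpha> p)"

text \<open>The numerator of the quotient without its factor \<open>1 / p\<close>; a minimiser with
  denominator 1 therefore has energy \<open>p * \<Lambda>\<close>.\<close>

definition energy :: "('a \<Rightarrow> real) \<Rightarrow> ('a \<Rightarrow> real) \<Rightarrow> real" where
  "energy u v = enn2real (gagliardo_pow s p u) + enn2real (gagliardo_pow t p v)"

abbreviation "Q' \<equiv> Q s t \<alpha> \<beta> \<Omega> x0 p"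
abbreviation "Xstar \<equiv> X_star s t \<alpha> \<Omega> x0 p"
abbreviation "\<Lambda> \<equiv> Lambda1 s t \<alpha> \<beta> \<Omega> x0 p"

section \<open>Elementary properties of the quotient and of the admissible class\<close>

lemma Q_eq: "Q' u v = energy u v / (p * (mass u * \<bar>v x0\<bar> powr \<beta> p))"
  by (simp add: Q_def mass_def energy_def add_divide_distrib[symmetric])

lemma mass_nonneg: "0 \<le> mass u"
  unfolding mass_def set_lebesgue_integral_def by (intro Bochner_Integration.integral_nonneg) auto

lemma energy_nonneg: "0 \<le> energy u v"
  by (simp add: energy_def)

lemma Q_nonneg: "0 \<le> Q' u v"
  unfolding Q_eq using p by (intro divide_nonneg_nonneg mult_nonneg_nonneg energy_nonneg mass_nonneg) auto

lemma mass_integrable: "continuous_on UNIV u \<Longrightarrow> set_integrable lebesgue \<Omega> (\<lambda>x. \<bar>u x\<bar> powr \<alpha> p)"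
  using set_integrable_abs_powr open_\<Omega> bounded_\<Omega> \<alpha> by blast

lemma mass_mono:
  assumes "continuous_on UNIV u" "continuous_on UNIV w" "\<And>x. \<bar>u x\<bar> \<le> \<bar>w x\<bar>"
  shows "mass u \<le> mass w"
  unfolding mass_def
  by (intro set_integral_mono mass_integrable powr_mono2) (use assms \<alpha> in auto)

lemma mass_cmult: "mass (\<lambda>x. c * u x) = \<bar>c\<bar> powr \<alpha> p * mass u"
  by (simp add: mass_def abs_mult powr_mult)

lemma X_star_iff:
  "(u, v) \<in> Xstar \<longleftrightarrow> u \<in> W0 s p \<Omega> \<and> continuous_on UNIV u \<and> v \<in> W0 t p \<Omega> \<and> continuous_on UNIV v \<and>
     0 < mass u \<and> v x0 \<noteq> 0"
  using mass_nonneg[of u] by (auto simp: X_star_def X_space_def mass_def[symmetric] order.strict_iff_order)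

lemma W0D:
  assumes "u \<in> W0 r p \<Omega>"
  shows "AE x in lebesgue. x \<notin> \<Omega> \<longrightarrow> u x = 0" "gagliardo_pow r p u < \<infinity>"
  using assms by (auto simp: W0_def)

lemma W0I:
  assumes "continuous_on UNIV u" "AE x in lebesgue. x \<notin> \<Omega> \<longrightarrow> u x = 0" "gagliardo_pow r p u < \<infinity>"
  shows "u \<in> W0 r p \<Omega>"
  using assms p bounded_\<Omega> by (intro W0_continuousI) auto

lemma W0_cmult:
  assumes "u \<in> W0 r p \<Omega>" "continuous_on UNIV u"
  shows "(\<lambda>x. c * u x) \<in> W0 r p \<Omega>"
proof (rule W0I)
  show "continuous_on UNIV (\<lambda>x. c * u x)"
    using assms by (intro continuous_intros)
  show "AE x in lebesgue. x \<notin> \<Omega> \<longrightarrow> c * u x = 0"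
    using W0D(1)[OF assms(1)] by eventually_elim auto
  show "gagliardo_pow r p (\<lambda>x. c * u x) < \<infinity>"
    using W0D(2)[OF assms(1)] by (simp add: gagliardo_pow_cmult[OF assms(2)] ennreal_mult_less_top)
qed

lemma gagliardo_abs: "gagliardo_pow r p (\<lambda>x. \<bar>u x\<bar>) \<le> gagliardo_pow r p u"
  using p by (intro gagliardo_pow_mono abs_triangle_ineq3) auto

lemma W0_abs:
  assumes "u \<in> W0 r p \<Omega>" "continuous_on UNIV u"
  shows "(\<lambda>x. \<bar>u x\<bar>) \<in> W0 r p \<Omega>"
proof (rule W0I)
  show "continuous_on UNIV (\<lambda>x. \<bar>u x\<bar>)"
    using assms by (intro continuous_intros)
  show "AE x in lebesgue. x \<notin> \<Omega> \<longrightarrow> \<bar>u x\<bar> = 0"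
    using W0D(1)[OF assms(1)] by eventually_elim auto
  show "gagliardo_pow r p (\<lambda>x. \<bar>u x\<bar>) < \<infinity>"
    using gagliardo_abs W0D(2)[OF assms(1)] by (rule order_le_less_trans)
qed

lemma W0_add:
  assumes u: "u \<in> W0 r p \<Omega>" "continuous_on UNIV u" and \<phi>: "\<phi> \<in> W0 r p \<Omega>" "continuous_on UNIV \<phi>"
  shows "(\<lambda>x. u x + \<phi> x) \<in> W0 r p \<Omega>"
proof (rule W0I)
  show c: "continuous_on UNIV (\<lambda>x. u x + \<phi> x)"
    using assms by (intro continuous_intros)
  show "AE x in lebesgue. x \<notin> \<Omega> \<longrightarrow> u x + \<phi> x = 0"
    using W0D(1)[OF u(1)] W0D(1)[OF \<phi>(1)] by eventually_elim auto
  show "gagliardo_pow r p (\<lambda>x. u x + \<phi> x) < \<infinity>"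
    by (rule gagliardo_pow_finite_of_lipschitz[where C = 1, OF _ u(2) \<phi>(2) c W0D(2)[OF u(1)] W0D(2)[OF \<phi>(1)]])
      (use p in auto)
qed

text \<open>Scaling both components by \<open>c\<close> multiplies the denominator \<open>D\<close>
  by \<open>c powr (\<alpha> p + \<beta> p) = c powr p\<close>, and the energy by the same factor.
  The choice \<open>c = D powr (- 1 / p)\<close> makes this factor \<open>1 / D\<close>.\<close>

lemma X_star_normalize:
  assumes "(u, v) \<in> Xstar"
  obtains u' v' where "(u', v') \<in> Xstar" "mass u' * \<bar>v' x0\<bar> powr \<beta> p = 1" "energy u' v' = p * Q' u v"
proof -
  define D where "D = mass u * \<bar>v x0\<bar> powr \<beta> p"
  define c where "c = D powr (- 1 / p)"
  have *: "u \<in> W0 s p \<Omega>" "continuous_on UNIV u" "v \<in> W0 t p \<Omega>" "continuous_on UNIV v" "0 < mass u" "v x0 \<noteq> 0"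
    using assms by (auto simp: X_star_iff)
  have D: "0 < D" using * by (simp add: D_def)
  then have c: "0 < c" by (simp add: c_def)
  have "c powr p = D powr (- 1)"
    unfolding c_def powr_powr using p by simp
  then have cp: "c powr p = 1 / D"
    using D by (simp add: powr_minus_divide)
  have "(\<lambda>x. c * u x, \<lambda>x. c * v x) \<in> Xstar"
    using * c by (auto simp: X_star_iff mass_cmult intro!: W0_cmult continuous_intros)
  moreover have "mass (\<lambda>x. c * u x) * \<bar>c * v x0\<bar> powr \<beta> p = 1"
  proof -
    have "mass (\<lambda>x. c * u x) * \<bar>c * v x0\<bar> powr \<beta> p = (c powr \<alpha> p * c powr \<beta> p) * D"
      using c by (simp add: mass_cmult D_def abs_mult powr_mult)
    also have "\<dots> = c powr p * D" by (simp add: powr_add[symmetric] \<alpha>\<beta>)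
    finally show ?thesis using cp D by simp
  qed
  moreover have "energy (\<lambda>x. c * u x) (\<lambda>x. c * v x) = p * Q' u v"
  proof -
    have "energy (\<lambda>x. c * u x) (\<lambda>x. c * v x) = c powr p * energy u v"
      using c * by (simp add: energy_def gagliardo_pow_cmult enn2real_mult distrib_left)
    then show ?thesis using p by (simp add: cp Q_eq D_def[symmetric])
  qed
  ultimately show thesis by (rule that)
qed

text \<open>Gives the infimum its meaning. A cutoff around \<open>x0\<close> serves as both
  components: it is 1 at \<open>x0\<close> and on a ball of positive measure inside
  \<open>\<Omega>\<close>.\<close>

lemma X_star_nonempty: "Xstar \<noteq> {}"
proof -
  obtain e where e: "0 < e" "cball x0 e \<subseteq> \<Omega>"
    using open_\<Omega> x0 open_contains_cball by blast
  define R where "R = e / 2"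
  have R: "0 < R" "cball x0 (2 * R) \<subseteq> \<Omega>" using e by (auto simp: R_def)
  let ?\<psi> = "cutoff x0 R"
  have W: "?\<psi> \<in> W0 r p \<Omega>" if "0 < r" "r < 1" for r
  proof (rule W0I)
    show "AE x in lebesgue. x \<notin> \<Omega> \<longrightarrow> ?\<psi> x = 0"
      using R cutoff_eq_0[OF R(1)] by (intro AE_I2) blast
    show "gagliardo_pow r p ?\<psi> < \<infinity>"
      using that p R by (intro gagliardo_pow_cutoff_finite) auto
  qed (rule continuous_cutoff)
  have sub: "cball x0 R \<subseteq> \<Omega>" using R by (intro order_trans[OF subset_cball R(2)]) simp
  have "0 < measure lebesgue (cball x0 R)"
    using R by simp
  also have "measure lebesgue (cball x0 R) = (\<integral>x. indicator (cball x0 R) x \<partial>lebesgue)"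
    by simp
  also have "\<dots> \<le> mass ?\<psi>"
    unfolding mass_def set_lebesgue_integral_def
  proof (rule integral_mono)
    show "integrable lebesgue (\<lambda>x. indicator \<Omega> x *\<^sub>R \<bar>?\<psi> x\<bar> powr \<alpha> p)"
      using mass_integrable[OF continuous_cutoff] unfolding set_integrable_def .
    show "integrable lebesgue (indicator (cball x0 R) :: 'a \<Rightarrow> real)"
      using emeasure_bounded_finite[of "cball x0 R"] by (intro integrable_real_indicator) auto
    show "indicator (cball x0 R) x \<le> indicator \<Omega> x *\<^sub>R \<bar>?\<psi> x\<bar> powr \<alpha> p" for x
      using sub cutoff_eq_1[OF R(1), of x x0] by (auto simp: indicator_def)
  qed
  finally have "0 < mass ?\<psi>" .
  moreover have "?\<psi> x0 \<noteq> 0"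
    using cutoff_eq_1[OF R(1), of x0 x0] R by simp
  ultimately have "(?\<psi>, ?\<psi>) \<in> Xstar"
    using W s t by (auto simp: X_star_iff continuous_cutoff)
  then show ?thesis by blast
qed

section \<open>Existence of a nonnegative normalised minimiser\<close>

lemma Lambda_le:
  assumes "(u, v) \<in> Xstar"
  shows "\<Lambda> \<le> Q' u v"
  unfolding Lambda1_def
  by (rule cINF_lower2[OF _ assms]) (auto intro!: bdd_belowI[of _ 0] Q_nonneg)

lemma Lambda_nonneg: "0 \<le> \<Lambda>"
  unfolding Lambda1_def using X_star_nonempty Q_nonneg by (intro cINF_greatest) auto

lemma near_minimizer:
  assumes "0 < e"
  obtains u v where "(u, v) \<in> Xstar" "Q' u v < \<Lambda> + e"
proof -
  have "\<exists>w\<in>Xstar. (case w of (u, v) \<Rightarrow> Q' u v) < \<Lambda> + e"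
  proof (rule ccontr)
    assume "\<not> ?thesis"
    then have "\<Lambda> + e \<le> (case w of (u, v) \<Rightarrow> Q' u v)" if "w \<in> Xstar" for w
      using that not_le by blast
    then have "\<Lambda> + e \<le> (INF (u, v)\<in>Xstar. Q' u v)"
      using X_star_nonempty by (intro cINF_greatest) auto
    then show False using assms by (simp add: Lambda1_def)
  qed
  then show thesis using that by auto
qed

text \<open>\<open>enn2real\<close> sends infinity to 0, so the real energy is faithful only because
  admissible functions have finite seminorms.\<close>

lemma gagliardo_sum_eq_energy:
  assumes "(u, v) \<in> Xstar"
  shows "gagliardo_pow s p u + gagliardo_pow t p v = ennreal (energy u v)"
  using W0D(2)[of u s] W0D(2)[of v t] assms
  by (simp add: X_star_iff energy_def)

text \<open>Dominated convergence; the constant \<open>\<bar>B\<bar> powr \<alpha> p\<close> is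
  integrable over the bounded set \<open>\<Omega>\<close>.\<close>

lemma mass_tendsto:
  assumes cont: "\<And>n. continuous_on UNIV (U n)" "continuous_on UNIV u"
    and lim: "\<And>x. (\<lambda>n. U n x) \<longlonglongrightarrow> u x" and B: "\<And>n x. \<bar>U n x\<bar> \<le> B"
  shows "(\<lambda>n. mass (U n)) \<longlonglongrightarrow> mass u"
  unfolding mass_def set_lebesgue_integral_def
proof (rule integral_dominated_convergence)
  show "integrable lebesgue (\<lambda>x. indicator \<Omega> x *\<^sub>R \<bar>B\<bar> powr \<alpha> p)"
    using mass_integrable[of "\<lambda>x. B"] unfolding set_integrable_def by simp
  show "(\<lambda>x. indicator \<Omega> x *\<^sub>R \<bar>u x\<bar> powr \<alpha> p) \<in> borel_measurable lebesgue"
    using mass_integrable[OF cont(2)] unfolding set_integrable_def by (rule borel_measurable_integrable)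
  show "(\<lambda>x. indicator \<Omega> x *\<^sub>R \<bar>U n x\<bar> powr \<alpha> p) \<in> borel_measurable lebesgue" for n
    using mass_integrable[OF cont(1)] unfolding set_integrable_def by (rule borel_measurable_integrable)
  show "AE x in lebesgue. (\<lambda>n. indicator \<Omega> x *\<^sub>R \<bar>U n x\<bar> powr \<alpha> p) \<longlonglongrightarrow> indicator \<Omega> x *\<^sub>R \<bar>u x\<bar> powr \<alpha> p"
    using \<alpha> by (intro AE_I2 tendsto_scaleR tendsto_const tendsto_powr' tendsto_rabs lim) auto
  show "AE x in lebesgue. norm (indicator \<Omega> x *\<^sub>R \<bar>U n x\<bar> powr \<alpha> p) \<le> indicator \<Omega> x *\<^sub>R \<bar>B\<bar> powr \<alpha> p" for n
  proof (rule AE_I2)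
    fix x
    have "\<bar>U n x\<bar> \<le> \<bar>B\<bar>" using B[of n x] by linarith
    then have "\<bar>U n x\<bar> powr \<alpha> p \<le> \<bar>B\<bar> powr \<alpha> p" using \<alpha> by (intro powr_mono2) auto
    then show "norm (indicator \<Omega> x *\<^sub>R \<bar>U n x\<bar> powr \<alpha> p) \<le> indicator \<Omega> x *\<^sub>R \<bar>B\<bar> powr \<alpha> p"
      by (simp add: indicator_def)
  qed
qed

lemma minimizer_exists:
  obtains u v where "(u, v) \<in> Xstar" "mass u * \<bar>v x0\<bar> powr \<beta> p = 1" "energy u v = p * \<Lambda>"
    "\<And>x. 0 \<le> u x" "\<And>x. 0 \<le> v x"
proof -
  define e where "e n = p * (\<Lambda> + inverse (real (Suc n)))" for n
  have "\<exists>u v. (u, v) \<in> Xstar \<and> mass u * \<bar>v x0\<bar> powr \<beta> p = 1 \<and> energy u v \<le> e n" for n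
  proof -
    obtain u v where uv: "(u, v) \<in> Xstar" "Q' u v < \<Lambda> + inverse (real (Suc n))"
      using near_minimizer[of "inverse (real (Suc n))"] by auto
    obtain u' v' where "(u', v') \<in> Xstar" "mass u' * \<bar>v' x0\<bar> powr \<beta> p = 1" "energy u' v' = p * Q' u v"
      using X_star_normalize[OF uv(1)] by blast
    moreover have "p * Q' u v \<le> e n"
      unfolding e_def using uv p by (intro mult_left_mono) auto
    ultimately show ?thesis by (intro exI[of _ u'] exI[of _ v']) simp
  qed
  then obtain U V where UV: "\<And>n. (U n, V n) \<in> Xstar" "\<And>n. mass (U n) * \<bar>V n x0\<bar> powr \<beta> p = 1"
    "\<And>n. energy (U n) (V n) \<le> e n"
    by metis
  have cont: "\<And>n. continuous_on UNIV (U n)" "\<And>n. continuous_on UNIV (V n)"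
    and W: "\<And>n. U n \<in> W0 s p \<Omega>" "\<And>n. V n \<in> W0 t p \<Omega>"
    using UV(1) by (auto simp: X_star_iff)
  have elim: "e \<longlonglongrightarrow> p * \<Lambda>"
    using tendsto_mult[OF tendsto_const[of p] tendsto_add[OF tendsto_const[of \<Lambda>] LIMSEQ_inverse_real_of_nat]]
    by (simp add: e_def[abs_def])
  have bound: "gagliardo_pow s p (U n) + gagliardo_pow t p (V n) \<le> ennreal (e n)" for n
    unfolding gagliardo_sum_eq_energy[OF UV(1)] using UV(3) by (rule ennreal_leI)
  \<comment> \<open>A bound for every \<open>e n\<close>, because
    \<open>inverse (Suc n) \<le> 1\<close>.\<close>
  define K where "K = p * (\<Lambda> + 1)"
  have K: "0 < K" using p Lambda_nonneg by (simp add: K_def add_nonneg_pos)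
  have eK: "e n \<le> K" for n
    unfolding e_def K_def using p by (intro mult_left_mono add_left_mono) (auto simp: inverse_le_1_iff)
  have sumK: "gagliardo_pow s p (U n) + gagliardo_pow t p (V n) \<le> ennreal K" for n
    using bound[of n] ennreal_leI[OF eK[of n]] by (rule order_trans)
  have gK: "gagliardo_pow s p (U n) \<le> ennreal K" "gagliardo_pow t p (V n) \<le> ennreal K" for n
    by (rule order_trans[OF _ sumK[of n]]; simp)+
  have vanish: "U n x = 0" "V n x = 0" if "x \<notin> closure \<Omega>" for n x
    using W0_vanishes_outside_closure[OF cont(1) W0D(1)[OF W(1)] that]
      W0_vanishes_outside_closure[OF cont(2) W0D(1)[OF W(2)] that] by auto
  obtain k u v B where k: "strict_mono (k :: nat \<Rightarrow> nat)" and cu: "continuous_on UNIV u" and cv: "continuous_on UNIV v"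
    and lu: "\<And>x. (\<lambda>n. U (k n) x) \<longlonglongrightarrow> u x" and lv: "\<And>x. (\<lambda>n. V (k n) x) \<longlonglongrightarrow> v x"
    and B: "\<And>n x. \<bar>U n x\<bar> \<le> B"
  proof -
    show thesis
      by (rule gagliardo_compactness[where U = U and V = V,
            OF bounded_\<Omega> less_imp_le[OF p] s(1,3) t(1,3) cont vanish K gK])
        (assumption, assumption, rule that)
  qed
  have lsc: "gagliardo_pow s p u + gagliardo_pow t p v \<le> ennreal (p * \<Lambda>)"
  proof (rule gagliardo_sum_lower_semicontinuous[where U = "\<lambda>n. U (k n)" and V = "\<lambda>n. V (k n)" and e = "\<lambda>n. e (k n)"])
    show "(\<lambda>n. e (k n)) \<longlonglongrightarrow> p * \<Lambda>"
      using LIMSEQ_subseq_LIMSEQ[OF elim k] by (simp add: o_def)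
  qed (use p cont cu cv lu lv bound in auto)
  have van: "AE x in lebesgue. x \<notin> \<Omega> \<longrightarrow> w x = 0"
    if "\<And>n. AE x in lebesgue. x \<notin> \<Omega> \<longrightarrow> F n x = 0" "\<And>x. (\<lambda>n. F (k n) x) \<longlonglongrightarrow> w x" for F and w :: "'a \<Rightarrow> real"
  proof -
    have "AE x in lebesgue. \<forall>n. x \<notin> \<Omega> \<longrightarrow> F n x = 0"
      unfolding AE_all_countable using that(1) by blast
    then show ?thesis
    proof eventually_elim
      case (elim x)
      show ?case
      proof
        assume "x \<notin> \<Omega>"
        then have "(\<lambda>n. F (k n) x) = (\<lambda>n. 0)" using elim by auto
        then show "w x = 0" using that(2)[of x] by (simp add: LIMSEQ_const_iff)
      qed
    qed
  qed
  have "gagliardo_pow s p u \<le> ennreal (p * \<Lambda>)" "gagliardo_pow t p v \<le> ennreal (p * \<Lambda>)"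
    by (rule order_trans[OF _ lsc]; simp)+
  then have gfin: "gagliardo_pow s p u < \<infinity>" "gagliardo_pow t p v < \<infinity>"
    by (auto intro: order_le_less_trans)
  have uW: "u \<in> W0 s p \<Omega>"
    using cu van[OF W0D(1)[OF W(1)] lu] gfin(1) by (rule W0I)
  have vW: "v \<in> W0 t p \<Omega>"
    using cv van[OF W0D(1)[OF W(2)] lv] gfin(2) by (rule W0I)
  \<comment> \<open>The constraint survives the limit: the integral by dominated convergence, the
    point value by pointwise convergence at \<open>x0\<close>. In particular the limit cannot
    degenerate.\<close>
  have "(\<lambda>n. mass (U (k n)) * \<bar>V (k n) x0\<bar> powr \<beta> p) \<longlonglongrightarrow> mass u * \<bar>v x0\<bar> powr \<beta> p"
    using \<beta> by (intro tendsto_mult mass_tendsto[OF cont(1) cu lu B] tendsto_powr' tendsto_rabs lv tendsto_const) auto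
  then have D: "mass u * \<bar>v x0\<bar> powr \<beta> p = 1"
    unfolding UV(2) by (simp add: LIMSEQ_const_iff)
  define u' where "u' x = \<bar>u x\<bar>" for x
  define v' where "v' x = \<bar>v x\<bar>" for x
  have D': "mass u' * \<bar>v' x0\<bar> powr \<beta> p = 1"
    using D by (simp add: u'_def v'_def mass_def)
  \<comment> \<open>Neither factor of a product equal to 1 can vanish, and
    \<open>0 powr \<beta> p = 0\<close>.\<close>
  have "0 < mass u'" "v' x0 \<noteq> 0"
    using D' mass_nonneg[of u'] by (auto simp: order.strict_iff_order)
  then have star: "(u', v') \<in> Xstar"
    using uW vW cu cv W0_abs unfolding X_star_iff u'_def[abs_def] v'_def[abs_def]
    by (auto intro!: continuous_intros)
  \<comment> \<open>Taking absolute values preserves the denominator and does not increase the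
    energy, so \<open>(u', v')\<close> is squeezed between the limit energy and the infimum.\<close>
  have "ennreal (energy u' v') = gagliardo_pow s p u' + gagliardo_pow t p v'"
    by (rule gagliardo_sum_eq_energy[OF star, symmetric])
  also have "\<dots> \<le> gagliardo_pow s p u + gagliardo_pow t p v"
    unfolding u'_def[abs_def] v'_def[abs_def] by (intro add_mono gagliardo_abs)
  also note lsc
  finally have "energy u' v' \<le> p * \<Lambda>"
    using p Lambda_nonneg by (subst (asm) ennreal_le_iff) auto
  moreover have "p * \<Lambda> \<le> energy u' v'"
    using Lambda_le[OF star] p by (simp add: Q_eq D' field_simps)
  ultimately have "energy u' v' = p * \<Lambda>" by simp
  then show thesis
    by (rule that[OF star D']) (auto simp: u'_def v'_def)
qed

text \<open>The competitor has denominator \<open>D \<ge> 1\<close>, whence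
  \<open>p * \<Lambda> \<le> energy u' v' / D \<le> energy u' v'\<close>. This supplies the
  comparison hypothesis of the minimum principle.\<close>

lemma energy_le_of_larger:
  assumes uv: "mass u * \<bar>v x0\<bar> powr \<beta> p = 1" "energy u v = p * \<Lambda>"
    and w: "(u', v') \<in> Xstar" "mass u * \<bar>v x0\<bar> powr \<beta> p \<le> mass u' * \<bar>v' x0\<bar> powr \<beta> p"
  shows "energy u v \<le> energy u' v'"
proof -
  define D where "D = mass u' * \<bar>v' x0\<bar> powr \<beta> p"
  have D: "1 \<le> D" using uv w by (simp add: D_def)
  have "p * \<Lambda> \<le> p * Q' u' v'"
    using Lambda_le[OF w(1)] p by simp
  also have "\<dots> = energy u' v' / D"
    using p by (simp add: Q_eq D_def)
  also have "\<dots> \<le> energy u' v'"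
    using D energy_nonneg[of u' v'] by (simp add: divide_le_eq mult_left_mono[of 1 D, simplified])
  finally show ?thesis using uv by simp
qed

text \<open>If the infimum were 0, the second component of a minimiser would have zero seminorm. By
  the Morrey inequality it would be constant, hence zero as it vanishes outside the closure of
  \<open>\<Omega>\<close>, against \<open>v x0 \<noteq> 0\<close>.\<close>

lemma Lambda_pos: "0 < \<Lambda>"
proof (rule ccontr)
  assume "\<not> 0 < \<Lambda>"
  then have L: "\<Lambda> = 0" using Lambda_nonneg by simp
  obtain u v where uv: "(u, v) \<in> Xstar" "energy u v = p * \<Lambda>" "\<And>x. 0 \<le> v x"
    using minimizer_exists by metis
  have v: "v \<in> W0 t p \<Omega>" "continuous_on UNIV v" "v x0 \<noteq> 0"
    using uv by (auto simp: X_star_iff)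
  have g0: "gagliardo_pow t p v = 0"
    using uv(2) L gagliardo_sum_eq_energy[OF uv(1)] by simp
  obtain y where y: "y \<notin> closure \<Omega>"
    using bounded_\<Omega> bounded_closure not_bounded_UNIV by (metis UNIV_eq_I)
  then have vy: "v y = 0"
    using W0_vanishes_outside_closure[OF v(2) W0D(1)[OF v(1)]] by blast
  define H where "H = morrey_const TYPE('a) t p * dist x0 y powr (t - real DIM('a) / p)"
  have "x0 \<noteq> y" using x0 y closure_subset by blast
  then have H: "0 < H"
    using morrey_const_pos[of p t, where 'a = 'a] p t by (simp add: H_def)
  have v0: "0 < v x0" using v(3) uv(3)[of x0] by simp
  \<comment> \<open>With this value the Morrey bound on \<open>v x0 - v y\<close> is half of
    \<open>v x0\<close>.\<close>
  define M where "M = (v x0 / (2 * H)) powr p"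
  have M: "0 < M" using v0 H by (simp add: M_def)
  have "\<bar>v x0 - v y\<bar> \<le> morrey_const TYPE('a) t p * M powr (1 / p) * dist x0 y powr (t - real DIM('a) / p)"
    using g0 M p t by (intro W0_hoelder v) auto
  also have "\<dots> = H * M powr (1 / p)" by (simp add: H_def)
  also have "M powr (1 / p) = v x0 / (2 * H)"
    using v0 H p by (simp add: M_def powr_powr)
  finally show False using v0 H vy by simp
qed

text \<open>Only one component is perturbed at a time; the energy of the other is common to both
  sides and cancels, so the comparison of total energies becomes one of single seminorms. The
  minimum principle starts for \<open>v\<close> from \<open>x0\<close> and for \<open>u\<close> from
  a point furnished by the positive integral.\<close>

lemma positive_minimizer:
  assumes uv: "(u, v) \<in> Xstar" "mass u * \<bar>v x0\<bar> powr \<beta> p = 1" "energy u v = p * \<Lambda>"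
    and nonneg: "\<And>x. 0 \<le> u x" "\<And>x. 0 \<le> v x" and x: "x \<in> \<Omega>"
  shows "0 < u x" "0 < v x"
proof -
  have *: "u \<in> W0 s p \<Omega>" "continuous_on UNIV u" "v \<in> W0 t p \<Omega>" "continuous_on UNIV v" "0 < mass u" "v x0 \<noteq> 0"
    using uv by (auto simp: X_star_iff)
  have fin: "gagliardo_pow s p u < \<infinity>" "gagliardo_pow t p v < \<infinity>"
    using W0D(2)[OF *(1)] W0D(2)[OF *(3)] by auto
  have W\<phi>: "\<phi> \<in> W0 r p \<Omega>" if "continuous_on UNIV \<phi>" "\<And>x. x \<notin> \<Omega> \<Longrightarrow> \<phi> x = 0" "gagliardo_pow r p \<phi> < \<infinity>" for \<phi> r
    using that by (intro W0I AE_I2) auto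
  \<comment> \<open>Finiteness is needed to lift the comparison of real energies back to
    \<open>ennreal\<close>.\<close>
  have le: "a \<le> b" if "enn2real a \<le> enn2real b" "a < \<infinity>" "b < \<infinity>" for a b
    using that by (metis ennreal_enn2real ennreal_leI infinity_ennreal_def)
  show "0 < v x"
  proof (rule strong_minimum_principle[OF p t open_\<Omega> connected_\<Omega> *(4) nonneg(2) fin(2) _ x0 *(6) x])
    fix \<phi> :: "'a \<Rightarrow> real"
    assume \<phi>: "continuous_on UNIV \<phi>" "\<And>x. 0 \<le> \<phi> x" "\<And>x. x \<notin> \<Omega> \<Longrightarrow> \<phi> x = 0" "gagliardo_pow t p \<phi> < \<infinity>"
    let ?w = "\<lambda>x. v x + \<phi> x"
    have W: "?w \<in> W0 t p \<Omega>"
      using W0_add[OF *(3,4) W\<phi>[OF \<phi>(1,3,4)] \<phi>(1)] .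
    have "?w x0 \<noteq> 0" using \<phi>(2)[of x0] nonneg(2)[of x0] *(6) by linarith
    then have "(u, ?w) \<in> Xstar"
      using W * \<phi>(1) by (auto simp: X_star_iff intro!: continuous_intros)
    moreover have "\<bar>v x0\<bar> powr \<beta> p \<le> \<bar>?w x0\<bar> powr \<beta> p"
      using \<phi>(2)[of x0] nonneg(2)[of x0] \<beta> by (intro powr_mono2) auto
    ultimately have "energy u v \<le> energy u ?w"
      using mass_nonneg[of u] by (intro energy_le_of_larger uv mult_left_mono) auto
    then show "gagliardo_pow t p v \<le> gagliardo_pow t p ?w"
      using fin(2) W0D(2)[OF W] by (intro le) (auto simp: energy_def)
  qed
  have "\<exists>y\<in>\<Omega>. u y \<noteq> 0"
  proof (rule ccontr)
    assume "\<not> ?thesis"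
    then have eq: "(\<lambda>x. indicator \<Omega> x *\<^sub>R \<bar>u x\<bar> powr \<alpha> p) = (\<lambda>x. 0)"
      using \<alpha> by (auto simp: indicator_def fun_eq_iff)
    have "mass u = 0" unfolding mass_def set_lebesgue_integral_def eq by simp
    then show False using *(5) by simp
  qed
  then obtain y where y: "y \<in> \<Omega>" "u y \<noteq> 0" by blast
  show "0 < u x"
  proof (rule strong_minimum_principle[OF p s open_\<Omega> connected_\<Omega> *(2) nonneg(1) fin(1) _ y x])
    fix \<phi> :: "'a \<Rightarrow> real"
    assume \<phi>: "continuous_on UNIV \<phi>" "\<And>x. 0 \<le> \<phi> x" "\<And>x. x \<notin> \<Omega> \<Longrightarrow> \<phi> x = 0" "gagliardo_pow s p \<phi> < \<infinity>"
    let ?w = "\<lambda>x. u x + \<phi> x"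
    have W: "?w \<in> W0 s p \<Omega>"
      using W0_add[OF *(1,2) W\<phi>[OF \<phi>(1,3,4)] \<phi>(1)] .
    have cw: "continuous_on UNIV ?w" using *(2) \<phi>(1) by (intro continuous_intros)
    have "\<bar>u x\<bar> \<le> \<bar>?w x\<bar>" for x
      using \<phi>(2)[of x] nonneg(1)[of x] by simp
    then have m: "mass u \<le> mass ?w"
      using *(2) cw by (intro mass_mono)
    then have "(?w, v) \<in> Xstar"
      using W * cw by (auto simp: X_star_iff)
    then have "energy u v \<le> energy ?w v"
      using m by (intro energy_le_of_larger uv mult_right_mono) auto
    then show "gagliardo_pow s p u \<le> gagliardo_pow s p ?w"
      using fin(1) W0D(2)[OF W] by (intro le) (auto simp: energy_def)
  qed
qed

lemma positive_normalized_minimizer_exists: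
  "0 < \<Lambda> \<and> (\<exists>(u, v)\<in>Xstar. \<Lambda> = Q' u v \<and> (\<forall>x\<in>\<Omega>. 0 < u x \<and> 0 < v x) \<and>
     (LINT x:\<Omega>|lebesgue. \<bar>u x\<bar> powr \<alpha> p) * \<bar>v x0\<bar> powr \<beta> p = 1)"
proof -
  obtain u v where uv: "(u, v) \<in> Xstar" "mass u * \<bar>v x0\<bar> powr \<beta> p = 1" "energy u v = p * \<Lambda>"
    and nonneg: "\<And>x. 0 \<le> u x" "\<And>x. 0 \<le> v x"
    using minimizer_exists by blast
  have "\<Lambda> = Q' u v" using uv p by (simp add: Q_eq)
  then show ?thesis
    using uv(1) uv(2)[unfolded mass_def] Lambda_pos positive_minimizer[OF uv nonneg] by blast
qed

end

theorem theorem1: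
  fixes \<Omega> :: "'a::euclidean_space set"
    and x0 :: 'a
    and s t \<theta> p :: real
    and \<alpha> \<beta> :: "real \<Rightarrow> real"
  assumes "bounded_smooth_domain \<Omega>"
    and "x0 \<in> \<Omega>"
    and "0 < s" "s \<le> t" "t < 1"
    and "\<And>q. q > real DIM('a) / s \<Longrightarrow> \<alpha> q > 1"
    and "\<And>q. q > real DIM('a) / s \<Longrightarrow> \<beta> q > 1"
    and "\<And>q. q > real DIM('a) / s \<Longrightarrow> \<alpha> q + \<beta> q = q"
    and "0 < \<theta>" "\<theta> < 1"
    and "((\<lambda>q. \<alpha> q / q) \<longlongrightarrow> \<theta>) at_top"
    and "p > real DIM('a) / s"
  shows "Lambda1 s t \<alpha> \<beta> \<Omega> x0 p > 0 \<and>
    (\<exists>(u, v) \<in> X_star s t \<alpha> \<Omega> x0 p.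
      Lambda1 s t \<alpha> \<beta> \<Omega> x0 p = Q s t \<alpha> \<beta> \<Omega> x0 p u v \<and>
      (\<forall>x\<in>\<Omega>. u x > 0 \<and> v x > 0) \<and>
      (LINT x:\<Omega>|lebesgue. \<bar>u x\<bar> powr \<alpha> p) * \<bar>v x0\<bar> powr \<beta> p = 1)"
proof -
  \<comment> \<open>Together these also yield \<open>p > 1\<close>, which the locale
    requires.\<close>
  have \<alpha>\<beta>: "1 < \<alpha> p" "1 < \<beta> p" "\<alpha> p + \<beta> p = p"
    using assms(6-8)[OF assms(12)] by auto
  have sp: "real DIM('a) < s * p"
    using assms(3,12) by (simp add: field_simps)
  moreover have "s * p \<le> t * p"
    using assms(4) \<alpha>\<beta> by (intro mult_right_mono) auto
  ultimately have tp: "real DIM('a) < t * p" by linarith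
  interpret gagliardo_system \<Omega> x0 s t p \<alpha> \<beta>
    using assms(1-5) \<alpha>\<beta> sp tp by unfold_locales (auto simp: bounded_smooth_domain_def)
  show ?thesis by (rule positive_normalized_minimizer_exists)
qed

end
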